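(* Let $f$ be a loss such that for every $z\in\mathcal{Z}$ the map $\mathbf{w}\mapsto f(\mathbf{w};z)$ is convex and $G$-Lipschitz on $\mathcal{W}$. Let $\beta\in(0,1)$, $\epsilon>0$, $\delta\in(0,1)$, and let $\sigma^2=\frac{14G^2T}{\beta n^2\epsilon}\big(\frac{\log(1/\delta)}{(1-\beta)\epsilon}+1\big)$ be the noise variance used by Algorithm 1 (described in the context) run for $T$ iterations on a dataset of size $n$. Set $\lambda=\frac{\log(1/\delta)}{(1-\beta)\epsilon}+1$. If $\sigma^2\ge 2.68G^2$ and $$\lambda-1\le \frac{\sigma^2}{6G^2}\log\Big(\frac{n}{\lambda\big(1+\frac{\sigma^2}{4G^2}\big)}\Big),$$ then Algorithm 1 satisfies $(\epsilon,\delta)$-differential privacy.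
   Context: Data space $\mathcal{Z}=\mathcal{X}\times\mathcal{Y}$ with $\mathcal{X}\subset\mathbb{R}^d$, $\mathcal{Y}\subset\mathbb{R}$. $\mathcal{W}\subseteq\mathbb{R}^d$ is a convex set and $f:\mathcal{W}\times\mathcal{Z}\to\mathbb{R}$ a loss; $\partial f(\mathbf{w};z)$ denotes a (sub)gradient in $\mathbf{w}$. $f$ is $G$-Lipschitz if $|f(\mathbf{w};z)-f(\mathbf{w}';z)|\le G\|\mathbf{w}-\mathbf{w}'\|_2$ for all $\mathbf{w},\mathbf{w}'$. Algorithm 1 (DP-SGD for pointwise learning): input a dataset $S=\{z_1,\dots,z_n\}\subset\mathcal{Z}$, step sizes $\{\eta_t\}$, privacy parameters $\epsilon,\delta$, constant $\beta\in(0,1)$, Lipschitz parameter $G$, number of iterations $T$. Set $\mathbf{w}_1=\mathbf{0}$. For $t=1,\dots,T$: sample $i_t$ uniformly from $[n]=\{1,\dots,n\}$, draw $\mathbf{b}_t\sim\mathcal{N}(0,\sigma^2\mathbf{I}_d)$ with $\sigma^2=\frac{14G^2T}{\beta n^2\epsilon}\big(\frac{\log(1/\delta)}{(1-\beta)\epsilon}+1\big)$ (all random choices independent), and set $\mathbf{w}_{t+1}=\mathrm{Proj}_{\mathcal{W}}\big(\mathbf{w}_t-\eta_t(\partial f(\mathbf{w}_t;z_{i_t})+\mathbf{b}_t)\big)$, where $\mathrm{Proj}_{\mathcal{W}}$ is Euclidean projection onto $\mathcal{W}$. Output $\mathbf{w}_{\mathrm{priv}}=\frac1T\sum_{t=1}^T\mathbf{w}_t$.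 A randomized algorithm $\mathcal{A}$ is $(\epsilon,\delta)$-differentially private if for any two datasets $S,S'$ of size $n$ differing in exactly one data point and any measurable event $E$ of the output space, $\mathbb{P}(\mathcal{A}(S)\in E)\le e^{\epsilon}\mathbb{P}(\mathcal{A}(S')\in E)+\delta$.
   Formalization: W is assumed closed and non-empty, and the subgradients are assumed Borel measurable in w with norm at most G everywhere, including at boundary points of W and at the starting point 0, because a G-Lipschitz f can have larger subgradients at the boundary of W. *)

theory Defs
  imports "HOL-Analysis.Analysis" "HOL-Probability.Probability"
begin

definition gauss_vec :: "real \<Rightarrow> 'a::euclidean_space measure" where
  "gauss_vec s2 =
     distr (PiM Basis (\<lambda>_. density lborel (normal_density 0 (sqrt s2)))) borel
           (\<lambda>x. \<Sum>b\<in>Basis. x b *\<^sub>R b)"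

definition dpsgd_sigma2 :: "real \<Rightarrow> nat \<Rightarrow> nat \<Rightarrow> real \<Rightarrow> real \<Rightarrow> real \<Rightarrow> real" where
  "dpsgd_sigma2 G T n \<beta> \<epsilon> \<delta> =
     14 * G^2 * real T / (\<beta> * (real n)^2 * \<epsilon>) * (ln (1/\<delta>) / ((1 - \<beta>) * \<epsilon>) + 1)"

text \<open>One iteration t of Algorithm 1.  The state is (w_t, sum_{s<t} w_s);
  g is the (sub)gradient oracle, S the dataset (indices 0..n-1),
  eta the step sizes, s2 the noise variance.\<close>
definition dpsgd_step ::
  "('a::euclidean_space \<Rightarrow> 'z \<Rightarrow> 'a) \<Rightarrow> 'a set \<Rightarrow> 'z list \<Rightarrow> (nat \<Rightarrow> real) \<Rightarrow> real \<Rightarrow> nat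
     \<Rightarrow> 'a \<times> 'a \<Rightarrow> ('a \<times> 'a) measure" where
  "dpsgd_step g W S \<eta> s2 t = (\<lambda>(w, acc).
     measure_pmf (pmf_of_set {..<length S}) \<bind> (\<lambda>i.
       distr (gauss_vec s2) borel
         (\<lambda>b. (closest_point W (w - \<eta> t *\<^sub>R (g w (S ! i) + b)), acc + w))))"

primrec dpsgd_run ::
  "('a::euclidean_space \<Rightarrow> 'z \<Rightarrow> 'a) \<Rightarrow> 'a set \<Rightarrow> 'z list \<Rightarrow> (nat \<Rightarrow> real) \<Rightarrow> real \<Rightarrow> nat
     \<Rightarrow> ('a \<times> 'a) measure" where
  "dpsgd_run g W S \<eta> s2 0 = return borel (0, 0)"
| "dpsgd_run g W S \<eta> s2 (Suc t) = dpsgd_run g W S \<eta> s2 t \<bind> dpsgd_step g W S \<eta> s2 (Suc t)"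

definition dpsgd ::
  "('a::euclidean_space \<Rightarrow> 'z \<Rightarrow> 'a) \<Rightarrow> 'a set \<Rightarrow> (nat \<Rightarrow> real) \<Rightarrow> real \<Rightarrow> nat
     \<Rightarrow> 'z list \<Rightarrow> 'a measure" where
  "dpsgd g W \<eta> s2 T S = distr (dpsgd_run g W S \<eta> s2 T) borel (\<lambda>(w, acc). (1 / real T) *\<^sub>R acc)"

definition diff_private ::
  "('z list \<Rightarrow> 'a::topological_space measure) \<Rightarrow> nat \<Rightarrow> real \<Rightarrow> real \<Rightarrow> bool" where
  "diff_private A n \<epsilon> \<delta> \<longleftrightarrow>
     (\<forall>S S'. length S = n \<longrightarrow> length S' = n \<longrightarrow> card {i. i < n \<and> S ! i \<noteq> S' ! i} = 1 \<longrightarrow>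
        (\<forall>E \<in> sets borel. measure (A S) E \<le> exp \<epsilon> * measure (A S') E + \<delta>))"

end

theory Submission
  imports Defs
begin

text \<open>Put $p = 1/n$, $x = 4G^2/\sigma^2$ and let $\lambda$ be the order in the hypothesis. Before scaling and
  projection, one iteration on \<open>S\<close> and on \<open>S'\<close> produces two uniform mixtures \<open>P\<close>, \<open>Q\<close> of Gaussians
  with centres in a ball of radius \<open>G\<close>, which differ in a single component: $P = Q + p(A - B)$.
  A second order expansion of $(P/Q)^\lambda$ at 1, together with convexity of negative powers (which replaces
  \<open>Q\<close> in denominators by one of its components), reduces the Renyi moment to explicit Gaussian integrals:
  the chi-square type term contributes at most $3.2x$ per unit of $\lambda(\lambda-1)p^2/2$, up to a bounded factor,
  and the hypothesis makes $p$ so small that the higher order term cannot exceed what is left of $7x$.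
  Hence the Renyi divergence of one step is at most $3.5\lambda p^2 x$. This adds up over the \<open>T\<close> steps to
  $\beta\epsilon$, and the usual conversion to approximate privacy costs the remaining $(1-\beta)\epsilon$.\<close>

section \<open>Scalar inequalities\<close>

text \<open>Taylor's formula at 1 with Lagrange remainder. The intermediate point is at most
  \<open>max 1 r\<close>, and \<open>l >= 2\<close> makes the power in the second derivative
  nondecreasing, so the remainder is largest at that end.\<close>

lemma powr_le_second_order_Taylor:
  fixes r :: real
  assumes "2 \<le> l" "0 < r"
  shows "r powr l \<le> 1 + l * (r - 1) + l * (l - 1) / 2 * (r - 1)\<^sup>2 * max 1 r powr (l - 2)"
proof -
  \<comment> \<open>\<open>d m\<close> is the \<open>m\<close>-th derivative of
    \<open>x powr l\<close> up to \<open>m = 2\<close>, where the expansion stops.\<close>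
  define d where "d = (\<lambda>m::nat. \<lambda>x::real. if m = 0 then x powr l else if m = 1 then l * x powr (l - 1)
      else l * (l - 1) * x powr (l - 2))"
  have D: "DERIV (d m) t :> d (Suc m) t" if "m < 2" "0 < t" for m t
  proof -
    consider "m = 0" | "m = 1" using \<open>m < 2\<close> by linarith
    then show ?thesis
    proof cases
      case 1
      then show ?thesis using that unfolding d_def by (auto intro!: derivative_eq_intros)
    next
      case 2
      then show ?thesis using that unfolding d_def by (auto intro!: derivative_eq_intros simp: field_simps)
    qed
  qed
  have d2: "d 2 t / fact 2 * (r - 1)\<^sup>2 \<le> l * (l - 1) / 2 * (r - 1)\<^sup>2 * max 1 r powr (l - 2)"
    if "0 < t" "t \<le> max 1 r" for t
  proof -
    have "t powr (l - 2) \<le> max 1 r powr (l - 2)"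
      using that assms by (intro powr_mono2) auto
    then have "l * (l - 1) / 2 * (r - 1)\<^sup>2 * t powr (l - 2) \<le> l * (l - 1) / 2 * (r - 1)\<^sup>2 * max 1 r powr (l - 2)"
      using assms by (intro mult_left_mono) auto
    then show ?thesis by (simp add: d_def fact_2 mult_ac)
  qed
  have S: "(\<Sum>m<2. d m 1 / fact m * (r - 1) ^ m) = 1 + l * (r - 1)"
    by (simp add: numeral_2_eq_2 d_def)
  consider "r = 1" | "1 < r" | "r < 1" by linarith
  then show ?thesis
  proof cases
    case 1
    then show ?thesis by simp
  next
    case 2
    then have "\<exists>t. 1 < t \<and> t < r \<and> d 0 r = (\<Sum>m<2. d m 1 / fact m * (r - 1) ^ m) + d 2 t / fact 2 * (r - 1)\<^sup>2"
      by (intro Taylor_up[where a = 1 and diff = d and f = "d 0"]) (auto intro!: D)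
    then obtain t where "1 < t" "t < r" "d 0 r = 1 + l * (r - 1) + d 2 t / fact 2 * (r - 1)\<^sup>2"
      using S by auto
    then show ?thesis using d2[of t] by (simp add: d_def)
  next
    case 3
    then have "\<exists>t. r < t \<and> t < 1 \<and> d 0 r = (\<Sum>m<2. d m 1 / fact m * (r - 1) ^ m) + d 2 t / fact 2 * (r - 1)\<^sup>2"
      using assms by (intro Taylor_down[where b = 1 and diff = d and f = "d 0"]) (auto intro!: D)
    then obtain t where "r < t" "t < 1" "d 0 r = 1 + l * (r - 1) + d 2 t / fact 2 * (r - 1)\<^sup>2"
      using S by auto
    then show ?thesis using d2[of t] assms by (simp add: d_def)
  qed
qed

text \<open>Interpolation between the exponents 1 and 2: \<open>r powr l\<close> is a weighted
  geometric mean of \<open>r\<close> and the square of \<open>r\<close>, hence at most their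
  weighted arithmetic mean, which is the right side rearranged around \<open>r = 1\<close>.\<close>

lemma powr_le_quadratic:
  fixes r :: real
  assumes "1 \<le> l" "l \<le> 2" "0 < r"
  shows "r powr l \<le> 1 + l * (r - 1) + (l - 1) * (r - 1)\<^sup>2"
proof -
  have "r powr (2 - l) * (r\<^sup>2) powr (l - 1) \<le> (2 - l) * r + (l - 1) * r\<^sup>2"
    using assms by (intro Youngs_inequality_0) auto
  moreover have "r powr (2 - l) * (r\<^sup>2) powr (l - 1) = r powr l"
    using assms by (simp add: powr_powr powr_add[symmetric] flip: powr_numeral)
  ultimately show ?thesis
    by (simp add: power2_eq_square algebra_simps)
qed

text \<open>Bernoulli's inequality for exponents in [0,1], from the weighted mean inequality applied
  to \<open>1 + u\<close> and 1.\<close>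

lemma powr_one_plus_le_linear:
  fixes u :: real
  assumes "0 \<le> k" "k \<le> 1" "0 < u"
  shows "(1 + u) powr k \<le> 1 + k * u"
  using Youngs_inequality_0[of k "1 - k" "1 + u" 1] assms by (simp add: algebra_simps)

text \<open>Write \<open>1 + u\<close> as the convex combination of \<open>1 / (1 - t)\<close> and
  \<open>u / t\<close> with weights \<open>1 - t\<close> and \<open>t\<close>, then use convexity of
  the power. Keeping \<open>t\<close> free allows the constant term to be held close to 1.\<close>

lemma powr_one_plus_le_split:
  fixes u :: real
  assumes "1 \<le> k" "0 < u" "0 < t" "t < 1"
  shows "(1 + u) powr k \<le> (1 - t) powr (1 - k) + t powr (1 - k) * u powr k"
proof -
  have "((1 - t) * (1 / (1 - t)) + t * (u / t)) powr k \<le> (1 - t) * (1 / (1 - t)) powr k + t * (u / t) powr k"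
    using convex_onD[OF powr_convex[OF assms(1)], of t "1 / (1 - t)" "u / t"] assms by simp
  moreover have "(1 - t) * (1 / (1 - t)) + t * (u / t) = 1 + u"
    using assms by simp
  moreover have "(1 - t) * (1 / (1 - t)) powr k = (1 - t) powr (1 - k)"
    using assms by (simp add: powr_divide powr_diff)
  moreover have "t * (u / t) powr k = t powr (1 - k) * u powr k"
    using assms by (simp add: powr_divide powr_diff)
  ultimately show ?thesis by simp
qed

text \<open>Jensen's inequality for the convex function \<open>x powr (- s)\<close> with equal
  weights.\<close>

lemma powr_neg_mean_le:
  fixes x :: "'i \<Rightarrow> real"
  assumes "finite I" "I \<noteq> {}" "0 \<le> s" and x: "\<And>i. i \<in> I \<Longrightarrow> 0 < x i"
  shows "((\<Sum>i\<in>I. x i) / card I) powr (- s) \<le> (\<Sum>i\<in>I. x i powr (- s)) / card I"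
proof -
  have "convex_on {0<..} (\<lambda>x::real. x powr (- s))"
    using assms(3)
    by (intro f''_ge0_imp_convex[where f' = "\<lambda>x. - s * x powr (- s - 1)" and f'' = "\<lambda>x. s * (s + 1) * x powr (- s - 2)"])
      (auto intro!: derivative_eq_intros simp: algebra_simps)
  then have "(\<Sum>i\<in>I. (1 / card I) *\<^sub>R x i) powr (- s) \<le> (\<Sum>i\<in>I. 1 / card I * x i powr (- s))"
    using assms by (intro convex_on_sum) auto
  then show ?thesis
    by (simp add: sum_divide_distrib)
qed

section \<open>Numerical bounds for the exponential function\<close>

text \<open>A convex function lies below its chord. The right end of the range, 1/0.67 = 4/2.68, is
  the largest value of \<open>4 * G^2 / s2\<close> that the variance assumption permits; at that end
  \<open>exp (1 / 1.34)\<close> is compared with \<open>exp (3/4)\<close>, which a rational bound on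
  e controls.\<close>

lemma exp_half_le:
  fixes x :: real
  assumes "0 \<le> x" "x \<le> 1 / 0.67"
  shows "exp (x / 2) \<le> 1 + 0.751 * x"
proof -
  have "exp (3::real) = exp 1 ^ 3"
    by (simp flip: exp_of_nat_mult)
  also have "\<dots> \<le> (272 / 100) ^ 3"
    using e_less_272 by (intro power_mono) auto
  also have "\<dots> \<le> (2.12::real) ^ 4"
    by (simp add: power_numeral_reduce)
  finally have "exp (3/4) ^ 4 \<le> (2.12::real) ^ 4"
    by (simp flip: exp_of_nat_mult)
  then have e: "exp (3/4) \<le> (2.12::real)"
    by (rule power_mono_iff[THEN iffD1, rotated -1]) auto
  define t where "t = x * 0.67"
  have t: "0 \<le> t" "t \<le> 1" using assms by (auto simp: t_def)
  have "exp ((1 - t) * 0 + t * (1 / 1.34)) \<le> (1 - t) * exp 0 + t * exp (1 / 1.34 :: real)"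
    using convex_onD[OF exp_convex, of t 0 "1 / 1.34"] t by simp
  moreover have "exp (1 / 1.34 :: real) \<le> 2.12"
    by (rule order_trans[OF _ e]) simp
  then have "t * exp (1 / 1.34) \<le> t * 2.12"
    using t by (intro mult_left_mono) auto
  ultimately have "exp (t * (1 / 1.34)) \<le> 1 + 1.12 * t" by simp
  then show ?thesis using assms(1) by (simp add: t_def field_simps)
qed

lemma exp_minus_exp_half_le:
  fixes x :: real
  assumes "0 \<le> x" "x \<le> 1 / 0.67"
  shows "exp x - exp (x / 2) \<le> 1.6 * x"
proof -
  have "exp x - exp (x / 2) = exp (x / 2) * (exp (x / 2) - 1)"
    by (simp add: algebra_simps flip: exp_add)
  also have "\<dots> \<le> 2.125 * (0.751 * x)"
    using exp_half_le[OF assms] assms by (intro mult_mono) auto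
  finally show ?thesis using assms by simp
qed

text \<open>Two of the three factors \<open>exp (x / 2)\<close> are bounded by the constant 2.125
  and only the third keeps its dependence on \<open>x\<close>. The slack constant 5.7 is what the
  first case of the growth split can afford: 5.7 * 2/3 = 3.8 = 7 - 3.2.\<close>

lemma exp_three_halves_le:
  fixes x :: real
  assumes "0 \<le> x" "x \<le> 1 / 0.67"
  shows "exp (3 * x / 2) \<le> 5.7 * (1 + x)"
proof -
  have "exp (3 * x / 2) = exp (x / 2) ^ 2 * exp (x / 2)"
    by (simp add: power2_eq_square flip: exp_add)
  also have "\<dots> \<le> (2.125) ^ 2 * (1 + x)"
    using exp_half_le[OF assms] assms by (intro mult_mono power_mono) auto
  also have "\<dots> \<le> 5.7 * (1 + x)"
    using assms by (intro mult_right_mono) (auto simp: power2_eq_square)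
  finally show ?thesis .
qed

lemma exp_two_thirds_le: "exp (2 / 3) \<le> (1.95::real)"
proof -
  have "exp (2::real) = exp 1 ^ 2"
    by (simp flip: exp_of_nat_mult)
  also have "\<dots> \<le> (272 / 100) ^ 2"
    using e_less_272 by (intro power_mono) auto
  also have "\<dots> \<le> (1.95::real) ^ 3"
    by (simp add: power_numeral_reduce)
  finally have "exp (2/3) ^ 3 \<le> (1.95::real) ^ 3"
    by (simp flip: exp_of_nat_mult)
  then show ?thesis
    by (rule power_mono_iff[THEN iffD1, rotated -1]) auto
qed

text \<open>The weight $t = 1/(1.5(k+2))$ in the convexity split is small enough for $(1-t)^{1-k}$ to stay bounded
  in \<open>k\<close>, while $t^{1-k}$ is still absorbed by the factor $(k+2)^{-k}$ in $p^k$.\<close>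
lemma obtain_growth_split:
  fixes k :: real
  assumes "0 \<le> k"
  obtains C1 C2 \<kappa> :: real where "1 \<le> \<kappa>" "0 \<le> C1" "0 \<le> C2"
    "\<And>u. 0 < u \<Longrightarrow> (1 + u) powr k \<le> C1 + C2 * u powr \<kappa>"
    "\<And>x p. \<lbrakk>0 < x; x \<le> 1 / 0.67; 0 < p; p \<le> exp (- 1.5 * (k + 1) * x) / ((k + 2) * (1 + 1 / x))\<rbrakk>
       \<Longrightarrow> C1 * (3.2 * x) + C2 * (p powr \<kappa> * (2 * exp ((\<kappa> + 1) * (\<kappa> + 2) * x / 2))) \<le> 7 * x"
proof (cases "k \<le> 1")
  case True
  \<comment> \<open>Bernoulli gives the linear split. The first term costs 3.2 of the available 7,
    so the second must stay below 3.8.\<close>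
  show ?thesis
  proof (rule that[of 1 1 k])
    fix x p :: real
    assume x: "0 < x" "x \<le> 1 / 0.67" and p: "0 < p" "p \<le> exp (- 1.5 * (k + 1) * x) / ((k + 2) * (1 + 1 / x))"
    have "k * (p * (2 * exp (3 * x))) \<le> k * (exp (- 1.5 * (k + 1) * x) / ((k + 2) * (1 + 1 / x)) * (2 * exp (3 * x)))"
      using p assms by (intro mult_left_mono mult_right_mono) auto
    also have "\<dots> = k / (k + 2) * (2 * x / (1 + x)) * exp (3 * x / 2 - 1.5 * k * x)"
    proof -
      have "exp (3 * x / 2 - 1.5 * k * x) = exp (- 1.5 * (k + 1) * x) * exp (3 * x)"
        by (simp add: field_simps flip: exp_add)
      then show ?thesis using x assms by (simp add: field_simps)
    qed
    also have "\<dots> \<le> 1 / 3 * (2 * x / (1 + x)) * (5.7 * (1 + x))"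
    proof (intro mult_mono)
      have "exp (3 * x / 2 - 1.5 * k * x) \<le> exp (3 * x / 2)"
        using assms x by simp
      also have "\<dots> \<le> 5.7 * (1 + x)"
        using x by (intro exp_three_halves_le) auto
      finally show "exp (3 * x / 2 - 1.5 * k * x) \<le> 5.7 * (1 + x)" .
      show "k / (k + 2) \<le> 1 / 3" using assms True by (simp add: field_simps)
    qed (use x in simp_all)
    also have "\<dots> = 3.8 * x" using x by (simp add: field_simps)
    finally show "1 * (3.2 * x) + k * (p powr 1 * (2 * exp ((1 + 1) * (1 + 2) * x / 2))) \<le> 7 * x"
      using p by simp
  qed (use assms True powr_one_plus_le_linear[of k] in auto)
next
  case False
  define t where "t = 1 / (1.5 * (k + 2))"
  have t: "0 < t" "t < 1" using False by (auto simp: t_def field_simps)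
  show ?thesis
  proof (rule that[of k "(1 - t) powr (1 - k)" "t powr (1 - k)"])
    fix x p :: real
    assume x: "0 < x" "x \<le> 1 / 0.67" and p: "0 < p" "p \<le> exp (- 1.5 * (k + 1) * x) / ((k + 2) * (1 + 1 / x))"
    \<comment> \<open>The bound \<open>ln y <= y - 1\<close> at \<open>y = 1 / (1 - t)\<close> turns
      the exponent into \<open>(k - 1) / (1.5 * k + 2)\<close>, which stays below 2/3 for every
      \<open>k\<close>. The first term then costs 1.95 * 3.2 = 6.24.\<close>
    have "(1 - t) powr (1 - k) \<le> exp (2 / 3)"
    proof -
      have "- ln (1 - t) = ln (1 / (1 - t))" using t by (simp add: ln_div)
      also have "\<dots> \<le> 1 / (1 - t) - 1" using t by (intro ln_le_minus_one) auto
      also have "\<dots> = 1 / (1.5 * k + 2)" using False by (simp add: t_def field_simps)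
      finally have "(k - 1) * (- ln (1 - t)) \<le> (k - 1) * (1 / (1.5 * k + 2))"
        using False by (intro mult_left_mono) auto
      also have "\<dots> \<le> 2 / 3" using False by (simp add: field_simps)
      finally show ?thesis using t by (simp add: powr_def algebra_simps)
    qed
    then have 1: "(1 - t) powr (1 - k) * (3.2 * x) \<le> 1.95 * (3.2 * x)"
      using exp_two_thirds_le x by (intro mult_right_mono) auto
    have "p powr k \<le> (exp (- 1.5 * (k + 1) * x) / ((k + 2) * (1 + 1 / x))) powr k"
      using p False by (intro powr_mono2) auto
    also have "\<dots> = exp (- 1.5 * (k + 1) * k * x) / ((k + 2) powr k * (1 + 1 / x) powr k)"
      using x False by (simp add: powr_divide powr_mult exp_powr_real mult_ac)
    finally have "t powr (1 - k) * (p powr k * (2 * exp ((k + 1) * (k + 2) * x / 2))) \<le>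
       t powr (1 - k) * (exp (- 1.5 * (k + 1) * k * x) / ((k + 2) powr k * (1 + 1 / x) powr k)
         * (2 * exp ((k + 1) * (k + 2) * x / 2)))"
      by (intro mult_left_mono mult_right_mono) auto
    \<comment> \<open>The exponents add up to \<open>(k + 1) * (1 - k) * x\<close>, which is
      negative since \<open>k > 1\<close>; this is why the bound on \<open>p\<close> carries the
      constant 1.5. Every remaining factor is then bounded separately, for a total of 2/3 * x, and
      6.24 + 2/3 < 7.\<close>
    also have "\<dots> = 2 / (k + 2) * (1.5 / (1 + 1 / x)) powr (k - 1) * (1 / (1 + 1 / x)) * exp ((k + 1) * (1 - k) * x)"
    proof -
      have e: "exp ((k + 1) * (1 - k) * x) = exp (- 1.5 * (k + 1) * k * x) * exp ((k + 1) * (k + 2) * x / 2)"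
        by (simp add: field_simps flip: exp_add)
      have inv: "(1 / y) powr (1 - k) = y powr (k - 1)" if "0 < y" for y :: real
        using that by (simp add: powr_def ln_div algebra_simps)
      have "0 < 1.5 * (k + 2)" using False by simp
      from inv[OF this] have T: "t powr (1 - k) = 1.5 powr (k - 1) * (k + 2) powr (k - 1)"
        unfolding t_def by (simp only: powr_mult)
      have K: "(k + 2) powr k = (k + 2) powr (k - 1) * (k + 2)"
        using False by (simp add: powr_diff)
      have Z: "(1 + 1 / x) powr k = (1 + 1 / x) powr (k - 1) * (1 + 1 / x)"
        using x by (simp add: powr_diff)
      have cancel: "c * A * (e / (A * K * (D * z)) * (2 * e')) = 2 / K * (c / D) * (1 / z) * (e * e')"
        if "A \<noteq> 0" for c A e K D z e' :: real
      proof -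
        have "c * A * (e / (A * K * (D * z)) * (2 * e')) = (A / A) * (2 / K * (c / D) * (1 / z) * (e * e'))"
          by (simp only: divide_inverse inverse_mult_distrib mult_ac mult_1_left)
        moreover have "A / A = 1" using that by simp
        ultimately show ?thesis by (simp only: mult_1_left)
      qed
      show ?thesis
        unfolding e T K Z powr_divide[of "1.5" "1 + 1 / x"] by (rule cancel) (use False in simp)
    qed
    also have "\<dots> \<le> 2 / 3 * 1 * x * 1"
    proof (intro mult_mono)
      have "1.5 / (1 + 1 / x) \<le> 1" using x by (simp add: field_simps)
      then show "(1.5 / (1 + 1 / x)) powr (k - 1) \<le> 1"
        using x False by (intro powr_le1) (auto simp: field_simps)
      show "exp ((k + 1) * (1 - k) * x) \<le> 1"
        using x False by (simp add: mult_nonneg_nonpos mult_nonpos_nonneg)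
      show "1 / (1 + 1 / x) \<le> x" using x by (simp add: field_simps)
      show "2 / (k + 2) \<le> 2 / 3" using False by (simp add: field_simps)
    qed (use x False in simp_all)
    finally have "t powr (1 - k) * (p powr k * (2 * exp ((k + 1) * (k + 2) * x / 2))) \<le> 2 / 3 * 1 * x * 1" .
    from add_mono[OF 1 this]
    show "(1 - t) powr (1 - k) * (3.2 * x) + t powr (1 - k) * (p powr k * (2 * exp ((k + 1) * (k + 2) * x / 2))) \<le> 7 * x"
      by (rule order_trans) (use x in simp)
  qed (use False t powr_one_plus_le_split[of k _ t] in auto)
qed

text \<open>With $P = e^{a/2}$, $Q = e^{b/2}$ and $R = e^{x/2}$ it suffices that $P^2 + Q^2 - 2PQ/R$ is at most $2R^2 - 2R$;
  the former grows in \<open>P\<close> and \<open>Q\<close> up to their bound \<open>R\<close>.\<close>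
lemma exp_second_difference_le:
  fixes a b c x :: real
  assumes "0 \<le> a" "0 \<le> b" "a \<le> x" "b \<le> x" "(a + b - x) / 2 \<le> c"
  shows "exp a + exp b - 2 * exp c \<le> 2 * (exp x - exp (x / 2))"
proof -
  define P Q R where "P = exp (a / 2)" and "Q = exp (b / 2)" and "R = exp (x / 2)"
  have b: "1 \<le> P" "1 \<le> Q" "P \<le> R" "Q \<le> R" using assms by (auto simp: P_def Q_def R_def)
  have sq: "exp a = P\<^sup>2" "exp b = Q\<^sup>2" "exp x = R\<^sup>2"
    by (simp_all add: P_def Q_def R_def flip: exp_double)
  have c: "P * Q / R \<le> exp c"
    using assms by (simp add: P_def Q_def R_def field_simps flip: exp_add exp_diff)
  have "Q / R \<le> 1" using b by simp
  then have "2 * (Q / R) \<le> R + P" using b by linarith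
  then have "0 \<le> (R - P) * (R + P - 2 * (Q / R))"
    using b by (intro mult_nonneg_nonneg) simp_all
  moreover have "(R - P) * (R + P - 2 * (Q / R)) = R\<^sup>2 - P\<^sup>2 - 2 * Q + 2 * (P * Q / R)"
    using b by (simp add: field_simps power2_eq_square)
  moreover have "0 \<le> (R - Q) * (R + Q - 2)"
    using b by (intro mult_nonneg_nonneg) auto
  ultimately show ?thesis
    using c unfolding sq R_def[symmetric] by (simp add: algebra_simps power2_eq_square)
qed

section \<open>Pointwise majorants of the Renyi integrand\<close>

text \<open>For positive numbers the difference is at most the maximum. The mixed expression is
  thereby separated into pure powers of \<open>A\<close> and of \<open>B\<close>, whose Gaussian
  moments are explicit.\<close>

lemma diff_square_mult_powr_le:
  fixes A B :: real
  assumes "0 < A" "0 < B" "0 \<le> \<kappa>"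
  shows "(A - B)\<^sup>2 * A powr \<kappa> \<le> A powr (\<kappa> + 2) + B powr (\<kappa> + 2)"
proof -
  have "(A - B)\<^sup>2 * A powr \<kappa> \<le> (max A B)\<^sup>2 * max A B powr \<kappa>"
    using assms by (intro mult_mono powr_mono2 power2_le_iff_abs_le[THEN iffD2]) auto
  also have "\<dots> = max A B powr (\<kappa> + 2)"
    using assms by (simp add: powr_add)
  also have "\<dots> \<le> A powr (\<kappa> + 2) + B powr (\<kappa> + 2)"
    by (auto simp: max_def)
  finally show ?thesis .
qed

text \<open>With \<open>r\<close> the ratio of the two mixtures, the left side is
  \<open>Q * r powr l\<close>, to which the Taylor bound applies. The linear term loses its
  denominator and will integrate to zero. In the remainder \<open>max 1 r\<close> is at most
  \<open>1 + p * A / Q\<close>, and \<open>split\<close> separates the constant part from the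
  growing part.\<close>

lemma perspective_powr_le:
  fixes A B Q p l :: real
  assumes pos: "0 < A" "0 < B" "0 < Q" "0 < p" "0 < Q + p * (A - B)" and l: "2 \<le> l" and \<kappa>: "1 \<le> \<kappa>"
    and split: "\<And>u. 0 < u \<Longrightarrow> (1 + u) powr (l - 2) \<le> C1 + C2 * u powr \<kappa>" and C: "0 \<le> C2"
  shows "(Q + p * (A - B)) powr l * Q powr (1 - l) \<le> Q + l * p * (A - B) + l * (l - 1) / 2 * p\<^sup>2 *
    (C1 * ((A - B)\<^sup>2 / Q) + C2 * p powr \<kappa> * ((A powr (\<kappa> + 2) + B powr (\<kappa> + 2)) * Q powr (- (\<kappa> + 1))))"
proof -
  define r where "r = 1 + p * (A - B) / Q"
  define u where "u = p * A / Q"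
  have r: "Q + p * (A - B) = Q * r" "0 < r"
    using pos by (auto simp: r_def field_simps)
  have u: "0 < u" "max 1 r \<le> 1 + u"
    using pos by (auto simp: u_def r_def field_simps)
  have "max 1 r powr (l - 2) \<le> (1 + u) powr (l - 2)"
    using u l by (intro powr_mono2) auto
  also have "\<dots> \<le> C1 + C2 * u powr \<kappa>" by (rule split) fact
  finally have m: "max 1 r powr (l - 2) \<le> C1 + C2 * u powr \<kappa>" .
  have D: "Q * (r - 1)\<^sup>2 = p\<^sup>2 * ((A - B)\<^sup>2 / Q)"
    using pos by (simp add: r_def power2_eq_square)
  have "Q powr (- (\<kappa> + 1)) = 1 / (Q * Q powr \<kappa>)"
    using pos by (simp add: powr_diff powr_minus_divide)
  moreover have "u powr \<kappa> = p powr \<kappa> * A powr \<kappa> / Q powr \<kappa>"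
    unfolding u_def by (simp only: powr_divide powr_mult)
  ultimately have "Q * (r - 1)\<^sup>2 * u powr \<kappa> = p\<^sup>2 * p powr \<kappa> * (((A - B)\<^sup>2 * A powr \<kappa>) * Q powr (- (\<kappa> + 1)))"
    unfolding D by (simp only: divide_inverse inverse_mult_distrib mult_ac mult_1_left)
  also have "\<dots> \<le> p\<^sup>2 * p powr \<kappa> * ((A powr (\<kappa> + 2) + B powr (\<kappa> + 2)) * Q powr (- (\<kappa> + 1)))"
    using pos \<kappa> by (intro mult_left_mono mult_right_mono diff_square_mult_powr_le) auto
  finally have E: "C2 * (Q * (r - 1)\<^sup>2 * u powr \<kappa>) \<le> C2 * (p\<^sup>2 * p powr \<kappa> * ((A powr (\<kappa> + 2) + B powr (\<kappa> + 2)) * Q powr (- (\<kappa> + 1))))"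
    using C by (rule mult_left_mono)
  have "(Q * r) powr l * Q powr (1 - l) = Q * r powr l"
    using pos r by (simp add: powr_mult powr_diff)
  also have "\<dots> \<le> Q * (1 + l * (r - 1) + l * (l - 1) / 2 * (r - 1)\<^sup>2 * max 1 r powr (l - 2))"
    using pos r l by (intro mult_left_mono powr_le_second_order_Taylor) auto
  also have "\<dots> \<le> Q * (1 + l * (r - 1) + l * (l - 1) / 2 * (r - 1)\<^sup>2 * (C1 + C2 * u powr \<kappa>))"
    using pos l m by (intro mult_left_mono add_left_mono) auto
  also have "\<dots> = Q + l * (Q * (r - 1)) + l * (l - 1) / 2 * (C1 * (Q * (r - 1)\<^sup>2) + C2 * (Q * (r - 1)\<^sup>2 * u powr \<kappa>))"
    by (simp only: distrib_left distrib_right mult_1_right mult_ac)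
  also have "\<dots> \<le> Q + l * (Q * (r - 1)) + l * (l - 1) / 2 * (C1 * (Q * (r - 1)\<^sup>2) +
      C2 * (p\<^sup>2 * p powr \<kappa> * ((A powr (\<kappa> + 2) + B powr (\<kappa> + 2)) * Q powr (- (\<kappa> + 1)))))"
    using l by (intro add_left_mono mult_left_mono[OF add_left_mono[OF E]]) auto
  also have "Q * (r - 1) = p * (A - B)" using pos by (simp add: r_def)
  finally show ?thesis unfolding r(1) D by (simp only: distrib_left mult_ac)
qed

lemma perspective_powr_le_quadratic:
  fixes A B Q p l :: real
  assumes pos: "0 < Q" "0 < Q + p * (A - B)" and l: "1 \<le> l" "l \<le> 2"
  shows "(Q + p * (A - B)) powr l * Q powr (1 - l) \<le> Q + l * p * (A - B) + (l - 1) * p\<^sup>2 * ((A - B)\<^sup>2 / Q)"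
proof -
  define r where "r = 1 + p * (A - B) / Q"
  have r: "Q + p * (A - B) = Q * r" "0 < r"
    using pos by (auto simp: r_def field_simps)
  have "(Q * r) powr l * Q powr (1 - l) = Q * r powr l"
    using pos r by (simp add: powr_mult powr_diff)
  also have "\<dots> \<le> Q * (1 + l * (r - 1) + (l - 1) * (r - 1)\<^sup>2)"
    using pos r l by (intro mult_left_mono powr_le_quadratic) auto
  also have "\<dots> = Q + l * p * (A - B) + (l - 1) * p\<^sup>2 * ((A - B)\<^sup>2 / Q)"
    using pos by (simp add: r_def power2_eq_square field_simps)
  finally show ?thesis unfolding r(1) .
qed

text \<open>Gives the orders \<open>l <= 2\<close> and \<open>l > 2\<close> one common shape, so
  that the integration is done once. The last clause is the budget: \<open>3.2 * x\<close> stands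
  for the chi-square type integral and the exponential for the moments of order
  \<open>\<kappa> + 2\<close>.\<close>

lemma obtain_moment_majorant:
  fixes l :: real
  assumes "1 < l"
  obtains C1 C2 \<kappa> :: real where "1 \<le> \<kappa>" "0 \<le> C1" "0 \<le> C2"
    "\<And>A B Q p. \<lbrakk>0 < A; 0 < B; 0 < Q; 0 < p; 0 < Q + p * (A - B)\<rbrakk> \<Longrightarrow>
       (Q + p * (A - B)) powr l * Q powr (1 - l) \<le> Q + l * p * (A - B) + l * (l - 1) / 2 * p\<^sup>2 *
        (C1 * ((A - B)\<^sup>2 / Q) + C2 * p powr \<kappa> * ((A powr (\<kappa> + 2) + B powr (\<kappa> + 2)) * Q powr (- (\<kappa> + 1))))"
    "\<And>x p. \<lbrakk>0 < x; x \<le> 1 / 0.67; 0 < p; p \<le> exp (- 1.5 * (l - 1) * x) / (l * (1 + 1 / x))\<rbrakk>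
       \<Longrightarrow> C1 * (3.2 * x) + C2 * (p powr \<kappa> * (2 * exp ((\<kappa> + 1) * (\<kappa> + 2) * x / 2))) \<le> 7 * x"
proof (cases "l \<le> 2")
  case True
  show ?thesis
  \<comment> \<open>\<open>C1 = 2 / l\<close> turns the coefficient \<open>l * (l - 1) / 2\<close>
    into the \<open>l - 1\<close> of the quadratic bound, and \<open>C2 = 0\<close> leaves no growth
    term.\<close>
  proof (rule that[of 1 "2 / l" 0])
    fix A B Q p :: real
    assume "0 < Q" "0 < Q + p * (A - B)"
    from perspective_powr_le_quadratic[OF this less_imp_le[OF assms] True]
    show "(Q + p * (A - B)) powr l * Q powr (1 - l) \<le> Q + l * p * (A - B) + l * (l - 1) / 2 * p\<^sup>2 *
        (2 / l * ((A - B)\<^sup>2 / Q) + 0 * p powr 1 * ((A powr (1 + 2) + B powr (1 + 2)) * Q powr (- (1 + 1))))"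
      using assms by simp
  next
    fix x p :: real
    assume x: "0 < x"
    have "2 / l * (3.2 * x) \<le> 2 * (3.2 * x)"
      using assms x by (intro mult_right_mono) (auto simp: field_simps)
    then show "2 / l * (3.2 * x) + 0 * (p powr 1 * (2 * exp ((1 + 1) * (1 + 2) * x / 2))) \<le> 7 * x"
      using x by simp
  qed (use assms in auto)
next
  case False
  then have "0 \<le> l - 2" by simp
  have eqs: "l - 2 + 1 = l - 1" "l - 2 + 2 = l" by auto
  show ?thesis
  proof (rule obtain_growth_split[OF \<open>0 \<le> l - 2\<close>, unfolded eqs])
    fix C1 C2 \<kappa> :: real
    assume \<kappa>: "1 \<le> \<kappa>" and C: "0 \<le> C1" "0 \<le> C2"
      and split: "\<And>u. 0 < u \<Longrightarrow> (1 + u) powr (l - 2) \<le> C1 + C2 * u powr \<kappa>"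
      and num: "\<And>x p. \<lbrakk>0 < x; x \<le> 1 / 0.67; 0 < p; p \<le> exp (- 1.5 * (l - 1) * x) / (l * (1 + 1 / x))\<rbrakk>
         \<Longrightarrow> C1 * (3.2 * x) + C2 * (p powr \<kappa> * (2 * exp ((\<kappa> + 1) * (\<kappa> + 2) * x / 2))) \<le> 7 * x"
    have "2 \<le> l" using False by simp
    from that[OF \<kappa> C perspective_powr_le[OF _ _ _ _ _ this \<kappa> split C(2)] num]
    show ?thesis .
  qed
qed

section \<open>Gaussian vectors and likelihood ratios\<close>

text \<open>The density of the Gaussian centred at \<open>m\<close> relative to the centred one. All
  laws are expressed by densities relative to the same \<open>gauss_vec s2\<close>.\<close>

definition gauss_lr :: "real \<Rightarrow> 'a::euclidean_space \<Rightarrow> 'a \<Rightarrow> real" where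
  "gauss_lr s2 m b = exp ((m \<bullet> b - (m \<bullet> m) / 2) / s2)"

lemma gauss_lr_pos: "0 < gauss_lr s2 m b"
  by (simp add: gauss_lr_def)

lemma gauss_lr_measurable [measurable]: "gauss_lr s2 m \<in> borel_measurable borel"
  unfolding gauss_lr_def by measurable

lemma prob_space_gauss_vec:
  assumes "s2 > 0"
  shows "prob_space (gauss_vec s2 :: 'a::euclidean_space measure)"
proof -
  interpret N: prob_space "density lborel (normal_density 0 (sqrt s2))"
    using assms by (intro prob_space_normal_density) simp
  interpret product_prob_space "\<lambda>_::'a. density lborel (normal_density 0 (sqrt s2))" Basis
    by unfold_locales
  show ?thesis
    unfolding gauss_vec_def by (intro prob_space_distr) measurable
qed

lemma sets_gauss_vec [measurable_cong, simp]: "sets (gauss_vec s2) = sets borel"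
  by (simp add: gauss_vec_def)

lemma space_gauss_vec [simp]: "space (gauss_vec s2) = UNIV"
  by (simp add: gauss_vec_def)

text \<open>A finite product measure is determined by its values on boxes, and on a box the integral
  of the product density factorises.\<close>

lemma PiM_density_lborel:
  fixes d :: "real \<Rightarrow> real"
  assumes [measurable]: "d \<in> borel_measurable borel" and d: "\<And>x. 0 \<le> d x" and I: "finite I"
    and fin: "sigma_finite_measure (density lborel d)"
  shows "PiM I (\<lambda>_. density lborel d) = density (PiM I (\<lambda>_. lborel)) (\<lambda>x. \<Prod>i\<in>I. ennreal (d (x i)))"
proof -
  interpret L: product_sigma_finite "\<lambda>_. lborel :: real measure"
    by unfold_locales
  interpret D: sigma_finite_measure "density lborel d" by fact
  interpret product_sigma_finite "\<lambda>_. density lborel d"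
    by unfold_locales
  show ?thesis
  proof (rule PiM_eqI[symmetric])
    show "finite I" by fact
    show "sets (density (PiM I (\<lambda>_. lborel)) (\<lambda>x. \<Prod>i\<in>I. ennreal (d (x i)))) = sets (PiM I (\<lambda>_. density lborel d))"
      by (simp cong: sets_PiM_cong)
    fix A :: "_ \<Rightarrow> real set" assume A: "\<And>i. i \<in> I \<Longrightarrow> A i \<in> sets (density lborel d)"
    then have [measurable]: "\<And>i. i \<in> I \<Longrightarrow> A i \<in> sets borel" by simp
    have "emeasure (density (PiM I (\<lambda>_. lborel)) (\<lambda>x. \<Prod>i\<in>I. ennreal (d (x i)))) (Pi\<^sub>E I A) =
      (\<integral>\<^sup>+ x. (\<Prod>i\<in>I. ennreal (d (x i))) * indicator (Pi\<^sub>E I A) x \<partial>PiM I (\<lambda>_. lborel))"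
      using I by (subst emeasure_density) auto
    also have "\<dots> = (\<integral>\<^sup>+ x. (\<Prod>i\<in>I. ennreal (d (x i)) * indicator (A i) (x i)) \<partial>PiM I (\<lambda>_. lborel))"
    proof (rule nn_integral_cong)
      \<comment> \<open>Membership in \<open>Pi\<^sub>E I A\<close> also demands extensionality,
        which points of the product space have; hence the indicator is the product of the coordinate
        indicators.\<close>
      fix x :: "_ \<Rightarrow> real" assume "x \<in> space (PiM I (\<lambda>_. lborel))"
      then have x: "x \<in> extensional I" by (simp add: space_PiM PiE_def)
      have "(\<Prod>i\<in>I. indicator (A i) (x i)) = (indicator (Pi\<^sub>E I A) x :: ennreal)"
      proof (cases "x \<in> Pi\<^sub>E I A")
        case True
        then show ?thesis by (auto intro!: prod.neutral simp: PiE_mem)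
      next
        case False
        with x show ?thesis using I by (auto simp: PiE_def indicator_def intro!: prod_zero)
      qed
      then show "(\<Prod>i\<in>I. ennreal (d (x i))) * indicator (Pi\<^sub>E I A) x =
          (\<Prod>i\<in>I. ennreal (d (x i)) * indicator (A i) (x i))"
        by (simp add: prod.distrib)
    qed
    also have "\<dots> = (\<Prod>i\<in>I. \<integral>\<^sup>+ x. ennreal (d x) * indicator (A i) x \<partial>lborel)"
      using I by (intro L.product_nn_integral_prod) auto
    also have "\<dots> = (\<Prod>i\<in>I. emeasure (density lborel d) (A i))"
      by (intro prod.cong) (auto simp: emeasure_density)
    finally show "emeasure (density (PiM I (\<lambda>_. lborel)) (\<lambda>x. \<Prod>i\<in>I. ennreal (d (x i)))) (Pi\<^sub>E I A)
      = (\<Prod>i\<in>I. emeasure (density lborel d) (A i))" .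
  qed
qed

definition gauss_vec_density :: "real \<Rightarrow> 'a::euclidean_space \<Rightarrow> real" where
  "gauss_vec_density s2 x = exp (- (x \<bullet> x) / (2 * s2)) / sqrt (2 * pi * s2) ^ DIM('a)"

lemma gauss_vec_density_measurable [measurable]: "gauss_vec_density s2 \<in> borel_measurable borel"
  unfolding gauss_vec_density_def by measurable

lemma gauss_vec_density_nonneg: "0 \<le> s2 \<Longrightarrow> 0 \<le> gauss_vec_density s2 x"
  by (simp add: gauss_vec_density_def)

text \<open>The product of the one-dimensional densities depends only on the norm of the assembled
  vector, so it passes through the pushforward that turns the product of Lebesgue measures into
  \<open>lborel\<close>.\<close>

lemma gauss_vec_eq_density:
  assumes "s2 > 0"
  shows "(gauss_vec s2 :: 'a::euclidean_space measure) = density lborel (gauss_vec_density s2)"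
proof -
  let ?d = "normal_density 0 (sqrt s2)"
  let ?\<phi> = "\<lambda>x::'a \<Rightarrow> real. \<Sum>b\<in>Basis. x b *\<^sub>R b"
  have dens: "ennreal (gauss_vec_density s2 (?\<phi> x)) = (\<Prod>b\<in>Basis. ennreal (?d (x b)))" for x
  proof -
    have "?\<phi> x \<bullet> ?\<phi> x = (\<Sum>b\<in>Basis. (x b)\<^sup>2)"
      by (subst euclidean_inner) (simp add: inner_sum_left inner_Basis if_distrib sum.delta power2_eq_square cong: if_cong)
    then have "(\<Prod>b\<in>(Basis::'a set). ?d (x b)) = gauss_vec_density s2 (?\<phi> x)"
      using assms
      by (simp add: normal_density_def gauss_vec_density_def prod.distrib exp_sum[symmetric]
          sum_divide_distrib[symmetric] sum_negf prod_dividef)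
    then show ?thesis by (simp add: prod_ennreal)
  qed
  have "sigma_finite_measure (density lborel ?d)"
    using assms by (intro prob_space_imp_sigma_finite prob_space_normal_density) simp
  then have "(gauss_vec s2 :: 'a measure) =
      distr (density (PiM Basis (\<lambda>_. lborel)) (\<lambda>x. \<Prod>b\<in>Basis. ennreal (?d (x b)))) borel ?\<phi>"
    unfolding gauss_vec_def by (subst PiM_density_lborel) auto
  also have "\<dots> = distr (density (PiM Basis (\<lambda>_. lborel)) (\<lambda>x. ennreal (gauss_vec_density s2 (?\<phi> x)))) borel ?\<phi>"
    by (simp add: dens)
  also have "\<dots> = density (distr (PiM Basis (\<lambda>_. lborel)) borel ?\<phi>) (gauss_vec_density s2)"
    by (subst density_distr) auto
  finally show ?thesis by (simp add: lborel_eq[symmetric])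
qed

text \<open>The finite-dimensional Cameron-Martin formula: Lebesgue measure is translation
  invariant, and the quotient of the shifted and the original density is
  \<open>gauss_lr\<close>.\<close>

lemma distr_gauss_vec_shift:
  fixes m :: "'a::euclidean_space"
  assumes "s2 > 0"
  shows "distr (gauss_vec s2) borel ((+) m) = density (gauss_vec s2) (gauss_lr s2 m)"
proof -
  have "distr (gauss_vec s2) borel ((+) m) =
      distr (density lborel (\<lambda>x. gauss_vec_density s2 ((m + x) - m))) borel ((+) m)"
    using assms by (simp add: gauss_vec_eq_density)
  also have "\<dots> = density (distr lborel borel ((+) m)) (\<lambda>x. gauss_vec_density s2 (x - m))"
    by (subst density_distr) auto
  also have "\<dots> = density lborel (\<lambda>x. gauss_vec_density s2 (x - m))"
    by (simp add: lborel_distr_plus)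
  also have "\<dots> = density lborel (\<lambda>x. ennreal (gauss_vec_density s2 x) * ennreal (gauss_lr s2 m x))"
  proof (rule arg_cong[where f="density lborel"], rule ext)
    fix x :: 'a
    have "gauss_vec_density s2 (x - m) = gauss_vec_density s2 x * gauss_lr s2 m x"
      using assms
      by (simp add: gauss_vec_density_def gauss_lr_def exp_add[symmetric] inner_diff_left
          inner_diff_right inner_commute field_simps)
    then show "ennreal (gauss_vec_density s2 (x - m)) = ennreal (gauss_vec_density s2 x) * ennreal (gauss_lr s2 m x)"
      using gauss_lr_pos[of s2 m x] gauss_vec_density_nonneg[OF less_imp_le[OF assms], of x]
      by (simp add: ennreal_mult)
  qed
  also have "\<dots> = density (gauss_vec s2) (gauss_lr s2 m)"
    using assms by (simp add: gauss_vec_eq_density density_density_eq)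
  finally show ?thesis .
qed

lemma integral_gauss_vec_shift:
  fixes m :: "'a::euclidean_space" and h :: "'a \<Rightarrow> real"
  assumes "s2 > 0" and [measurable]: "h \<in> borel_measurable borel"
  shows "(\<integral>b. h (m + b) \<partial>gauss_vec s2) = (\<integral>b. gauss_lr s2 m b * h b \<partial>gauss_vec s2)"
proof -
  have "(\<integral>b. h (m + b) \<partial>gauss_vec s2) = (\<integral>b. h b \<partial>distr (gauss_vec s2) borel ((+) m))"
    by (subst integral_distr) auto
  also have "\<dots> = (\<integral>b. gauss_lr s2 m b * h b \<partial>gauss_vec s2)"
    using gauss_lr_pos[of s2 m] unfolding distr_gauss_vec_shift[OF assms(1)]
    by (subst integral_density) (auto simp: less_imp_le)
  finally show ?thesis .
qed

text \<open>The value 1 is the total mass of a translated probability measure, so no Gaussian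
  integral has to be evaluated.\<close>

lemma has_bochner_integral_gauss_lr:
  assumes "s2 > 0"
  shows "has_bochner_integral (gauss_vec s2) (gauss_lr s2 m) 1"
proof (rule has_bochner_integral_nn_integral)
  interpret P: prob_space "distr (gauss_vec s2) borel ((+) m)"
    using prob_space_gauss_vec[OF assms] by (intro prob_space.prob_space_distr) auto
  have "emeasure (density (gauss_vec s2) (gauss_lr s2 m)) UNIV = 1"
    using P.emeasure_space_1 by (simp add: distr_gauss_vec_shift[OF assms, symmetric])
  then show "(\<integral>\<^sup>+ b. gauss_lr s2 m b \<partial>gauss_vec s2) = ennreal 1"
    by (simp add: emeasure_density)
qed (auto simp: gauss_lr_pos less_imp_le)

section \<open>Exponential moments of Gaussian vectors\<close>

text \<open>Completing the square writes the integrand as a constant times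
  \<open>gauss_lr s2 v\<close>.\<close>

lemma has_bochner_integral_exp_inner:
  assumes "s2 > 0"
  shows "has_bochner_integral (gauss_vec s2) (\<lambda>b. exp ((v \<bullet> b + c) / s2)) (exp ((v \<bullet> v / 2 + c) / s2))"
proof -
  have "has_bochner_integral (gauss_vec s2) (\<lambda>b. exp ((v \<bullet> v / 2 + c) / s2) * gauss_lr s2 v b)
     (exp ((v \<bullet> v / 2 + c) / s2) * 1)"
    by (intro has_bochner_integral_mult_right has_bochner_integral_gauss_lr assms)
  moreover have "exp ((v \<bullet> v / 2 + c) / s2) * gauss_lr s2 v b = exp ((v \<bullet> b + c) / s2)" for b
    by (simp add: gauss_lr_def exp_add[symmetric] add_divide_distrib[symmetric])
  ultimately show ?thesis by simp
qed

text \<open>The Renyi moment of order \<open>r + 1\<close> between Gaussians centred at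
  \<open>a\<close> and \<open>m\<close>. Logarithms of likelihood ratios are affine in
  \<open>b\<close>, so any product of their powers is an exponential of an affine function.\<close>

lemma gauss_lr_powr_moment:
  assumes "s2 > 0"
  shows "has_bochner_integral (gauss_vec s2)
    (\<lambda>b. gauss_lr s2 a b powr (r + 1) * gauss_lr s2 m b powr (- r)) (exp (r * (r + 1) * (norm (a - m))\<^sup>2 / (2 * s2)))"
proof -
  define v where "v = (r + 1) *\<^sub>R a - r *\<^sub>R m"
  define c where "c = - ((r + 1) * (a \<bullet> a) - r * (m \<bullet> m)) / 2"
  have pt: "gauss_lr s2 a b powr (r + 1) * gauss_lr s2 m b powr (- r) = exp ((v \<bullet> b + c) / s2)" for b
    using assms
    by (simp add: gauss_lr_def powr_def exp_add[symmetric] v_def c_def inner_diff_left inner_scaleR_left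
        add_divide_distrib[symmetric] diff_divide_distrib[symmetric] del: scaleR_left_distrib)
      (simp add: field_simps)
  have val: "(v \<bullet> v / 2 + c) / s2 = r * (r + 1) * (norm (a - m))\<^sup>2 / (2 * s2)"
    using assms
    by (simp add: v_def c_def power2_norm_eq_inner inner_diff_left inner_diff_right inner_add_left inner_add_right inner_commute field_simps)
  show ?thesis
    unfolding pt val[symmetric] by (rule has_bochner_integral_exp_inner[OF assms])
qed

lemma gauss_lr_prod_moment:
  assumes "s2 > 0"
  shows "has_bochner_integral (gauss_vec s2)
    (\<lambda>b. gauss_lr s2 a b * gauss_lr s2 a' b / gauss_lr s2 m b) (exp (((a - m) \<bullet> (a' - m)) / s2))"
proof -
  define v where "v = a + a' - m"
  define c where "c = - (a \<bullet> a + a' \<bullet> a' - m \<bullet> m) / 2"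
  have "gauss_lr s2 a b * gauss_lr s2 a' b / gauss_lr s2 m b = exp ((v \<bullet> b + c) / s2)" for b
    using assms
    by (simp add: gauss_lr_def exp_add[symmetric] exp_diff[symmetric] v_def c_def inner_diff_left inner_add_left
        add_divide_distrib[symmetric] diff_divide_distrib[symmetric] algebra_simps)
  moreover have "v \<bullet> v / 2 + c = (a - m) \<bullet> (a' - m)"
    by (simp add: v_def c_def inner_diff_left inner_diff_right inner_add_left inner_add_right inner_commute field_simps)
  ultimately show ?thesis
    using has_bochner_integral_exp_inner[OF assms, of v c] by simp
qed

section \<open>Renyi domination\<close>

text \<open>Young's inequality after dividing \<open>f\<close> and \<open>g\<close> by their norms.
  A vanishing norm forbids the division, but then the product is zero almost everywhere.\<close>

lemma integral_mult_le_Hoelder: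
  fixes f g :: "'a \<Rightarrow> real"
  assumes pq: "1 < p" "1 < q" "1 / p + 1 / q = 1"
    and [measurable]: "f \<in> borel_measurable M" "g \<in> borel_measurable M"
    and nonneg: "\<And>x. 0 \<le> f x" "\<And>x. 0 \<le> g x"
    and f: "integrable M (\<lambda>x. f x powr p)" and g: "integrable M (\<lambda>x. g x powr q)"
  shows "(\<integral>x. f x * g x \<partial>M) \<le> (\<integral>x. f x powr p \<partial>M) powr (1 / p) * (\<integral>x. g x powr q \<partial>M) powr (1 / q)"
proof -
  have Y: "u * v \<le> u powr p / p + v powr q / q" if "0 \<le> u" "0 \<le> v" for u v :: real
    using Youngs_inequality[OF pq that] .
  have int: "integrable M (\<lambda>x. f x * g x)"
  proof (rule Bochner_Integration.integrable_bound)
    show "integrable M (\<lambda>x. f x powr p / p + g x powr q / q)"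
      using f g by auto
    show "AE x in M. norm (f x * g x) \<le> norm (f x powr p / p + g x powr q / q)"
      using Y nonneg pq by (auto simp: abs_of_nonneg)
  qed measurable
  define A where "A = (\<integral>x. f x powr p \<partial>M)"
  define B where "B = (\<integral>x. g x powr q \<partial>M)"
  have "0 \<le> A" "0 \<le> B" by (auto simp: A_def B_def)
  have zero: "(\<integral>x. f x * g x \<partial>M) = 0" if "A = 0 \<or> B = 0"
  proof -
    have "AE x in M. f x * g x = 0"
      using that
    proof
      assume "A = 0"
      then have "AE x in M. f x powr p = 0"
        using f by (subst integral_nonneg_eq_0_iff_AE[symmetric]) (auto simp: A_def)
      then show ?thesis by eventually_elim auto
    next
      assume "B = 0"
      then have "AE x in M. g x powr q = 0"
        using g by (subst integral_nonneg_eq_0_iff_AE[symmetric]) (auto simp: B_def)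
      then show ?thesis by eventually_elim auto
    qed
    then show ?thesis by (rule integral_eq_zero_AE)
  qed
  have "(\<integral>x. f x * g x \<partial>M) \<le> A powr (1 / p) * B powr (1 / q)"
  proof (cases "A = 0 \<or> B = 0")
    case True
    then show ?thesis using zero by simp
  next
    case False
    then have pos: "0 < A" "0 < B" using \<open>0 \<le> A\<close> \<open>0 \<le> B\<close> by auto
    define \<alpha> \<beta> where "\<alpha> = A powr (1 / p)" and "\<beta> = B powr (1 / q)"
    have ab: "0 < \<alpha>" "0 < \<beta>" "\<alpha> powr p = A" "\<beta> powr q = B"
      using pos pq by (auto simp: \<alpha>_def \<beta>_def powr_powr)
    have "(\<integral>x. f x * g x \<partial>M) \<le> (\<integral>x. \<alpha> * \<beta> * (f x powr p / A / p + g x powr q / B / q) \<partial>M)"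
    proof (rule integral_mono[OF int])
      show "integrable M (\<lambda>x. \<alpha> * \<beta> * (f x powr p / A / p + g x powr q / B / q))"
        using f g by auto
      fix x
      have "\<alpha> * \<beta> * ((f x / \<alpha>) * (g x / \<beta>)) \<le> \<alpha> * \<beta> * ((f x / \<alpha>) powr p / p + (g x / \<beta>) powr q / q)"
        using ab nonneg by (intro mult_left_mono Y) (auto simp: less_imp_le)
      then show "f x * g x \<le> \<alpha> * \<beta> * (f x powr p / A / p + g x powr q / B / q)"
        using ab nonneg by (simp add: powr_divide)
    qed
    also have "\<dots> = \<alpha> * \<beta> * (A / A / p + B / B / q)"
      using f g by (simp add: A_def B_def)
    also have "\<dots> = \<alpha> * \<beta>"
      using pos pq by simp
    finally show ?thesis by (simp add: \<alpha>_def \<beta>_def)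
  qed
  then show "(\<integral>x. f x * g x \<partial>M) \<le> (\<integral>x. f x powr p \<partial>M) powr (1 / p) * (\<integral>x. g x powr q \<partial>M) powr (1 / q)"
    by (simp add: A_def B_def)
qed

text \<open>By duality of $L^q$ and $L^\lambda$ with $1/q + 1/\lambda = 1$ the bound below says that the integral of
  $(dM/dN)^\lambda$ with respect to \<open>N\<close> is at most $c^\lambda$, i.e. it bounds the Renyi divergence of order
  $\lambda$; but it refers to no densities and so passes directly through kernels.\<close>
definition renyi_dominated :: "real \<Rightarrow> real \<Rightarrow> 'a measure \<Rightarrow> 'a measure \<Rightarrow> bool" where
  "renyi_dominated c q M N \<longleftrightarrow> (\<forall>h\<in>borel_measurable M. (\<forall>x. 0 \<le> h x \<and> h x \<le> 1) \<longrightarrow>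
     (\<integral>x. h x \<partial>M) \<le> c * (\<integral>x. h x powr q \<partial>N) powr (1 / q))"

lemma renyi_dominatedD:
  assumes "renyi_dominated c q M N" "h \<in> borel_measurable M" "\<And>x. 0 \<le> h x" "\<And>x. h x \<le> 1"
  shows "(\<integral>x. h x \<partial>M) \<le> c * (\<integral>x. h x powr q \<partial>N) powr (1 / q)"
  using assms unfolding renyi_dominated_def by blast

lemma (in prob_space) integral_in_unit_interval:
  fixes h :: "'a \<Rightarrow> real"
  assumes "\<And>x. 0 \<le> h x" "\<And>x. h x \<le> 1"
  shows "(\<integral>x. h x \<partial>M) \<in> {0..1}"
proof (cases "integrable M h")
  case True
  then have "(\<integral>x. h x \<partial>M) \<le> (\<integral>x. 1 \<partial>M)"
    using assms by (intro integral_mono) auto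
  then show ?thesis using assms by (simp add: prob_space)
next
  \<comment> \<open>The Bochner integral of a non-integrable function is 0 by convention, which lies
    in the interval.\<close>
  case False
  then show ?thesis by (simp add: not_integrable_integral_eq)
qed

text \<open>Adaptive composition. Domination of the kernels bounds the inner integral of
  \<open>h\<close> by \<open>c' * k\<close>, where \<open>k powr q\<close> is the inner integral of
  \<open>h powr q\<close>. As \<open>k\<close> again takes values in [0,1], it is an admissible test
  function for the pair \<open>M\<close>, \<open>N\<close>, and its \<open>q\<close>-th power
  integrates back to that of \<open>h\<close>.\<close>

lemma renyi_dominated_bind:
  assumes dom: "renyi_dominated c q M N"
    and K: "K \<in> S \<rightarrow>\<^sub>M prob_algebra R" "K' \<in> S \<rightarrow>\<^sub>M prob_algebra R"
    and Kdom: "\<And>x. renyi_dominated c' q (K x) (K' x)"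
    and M: "prob_space M" "sets M = sets S" and N: "prob_space N" "sets N = sets S"
    and S: "space S = UNIV" and q: "0 < q" and c': "0 \<le> c'"
  shows "renyi_dominated (c' * c) q (M \<bind> K) (N \<bind> K')"
  unfolding renyi_dominated_def
proof (intro ballI impI)
  interpret M: prob_space M by fact
  interpret N: prob_space N by fact
  have meas [measurable_cong]: "sets M = sets S" "sets N = sets S" using M N by auto
  have KM [measurable]: "K \<in> M \<rightarrow>\<^sub>M subprob_algebra R" "K' \<in> N \<rightarrow>\<^sub>M subprob_algebra R" "K' \<in> M \<rightarrow>\<^sub>M subprob_algebra R"
    using K by (auto intro: measurable_prob_algebraD)
  have sp: "space M = UNIV" "space N = UNIV"
    using sets_eq_imp_space_eq[OF M(2)] sets_eq_imp_space_eq[OF N(2)] S by auto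
  have prK: "prob_space (K x)" "prob_space (K' x)" "sets (K x) = sets R" for x
    using K[THEN measurable_space, of x] by (auto simp: S space_prob_algebra)
  fix h :: "_ \<Rightarrow> real"
  assume "h \<in> borel_measurable (M \<bind> K)" and h: "\<forall>x. 0 \<le> h x \<and> h x \<le> 1"
  then have [measurable]: "h \<in> borel_measurable R"
    by (subst (asm) measurable_cong_sets[OF sets_bind refl, of _ _ R]) (auto simp: prK sp)
  define k where "k x = (\<integral>y. h y powr q \<partial>K' x) powr (1 / q)" for x
  have ksq: "k x powr q = (\<integral>y. h y powr q \<partial>K' x)" for x
    using q by (simp add: k_def powr_powr)
  have I: "(\<integral>y. h y powr q \<partial>K' x) \<in> {0..1}" for x
    using prK h q by (intro prob_space.integral_in_unit_interval) (auto intro: powr_le1)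
  have k: "0 \<le> k x" "k x \<le> 1" for x
    using I[of x] q by (auto simp: k_def intro: powr_le1)
  have km [measurable]: "k \<in> borel_measurable M"
    unfolding k_def by measurable
  have em: "emeasure (K x) (space (K x)) \<le> ennreal 1" "emeasure (K' x) (space (K' x)) \<le> ennreal 1" for x
    using prK[of x] by (auto simp: prob_space.emeasure_space_1)
  have "(\<integral>y. h y \<partial>(M \<bind> K)) = (\<integral>x. \<integral>y. h y \<partial>K x \<partial>M)"
    using h em by (intro integral_bind[where K=R and B=1 and B'=1]) (auto simp: M.finite_measure_axioms)
  also have "\<dots> \<le> (\<integral>x. c' * k x \<partial>M)"
  proof (rule integral_mono)
    show "integrable M (\<lambda>x. \<integral>y. h y \<partial>K x)"
      using prob_space.integral_in_unit_interval[OF prK(1), of h] h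
      by (intro M.integrable_const_bound[where B=1]) auto
    show "integrable M (\<lambda>x. c' * k x)"
      using k by (intro integrable_mult_right M.integrable_const_bound[where B=1]) auto
    show "(\<integral>y. h y \<partial>K x) \<le> c' * k x" for x
      unfolding k_def using h prK by (intro renyi_dominatedD[OF Kdom]) (auto cong: measurable_cong_sets)
  qed
  also have "\<dots> = c' * (\<integral>x. k x \<partial>M)" by simp
  also have "\<dots> \<le> c' * (c * (\<integral>x. k x powr q \<partial>N) powr (1 / q))"
    using k c' by (intro mult_left_mono renyi_dominatedD[OF dom]) auto
  also have "(\<integral>x. k x powr q \<partial>N) = (\<integral>y. h y powr q \<partial>(N \<bind> K'))"
    unfolding ksq using h em q
    by (intro integral_bind[symmetric, where K=R and B=1 and B'=1]) (auto simp: N.finite_measure_axioms powr_le1)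
  finally show "(\<integral>y. h y \<partial>(M \<bind> K)) \<le> c' * c * (\<integral>y. h y powr q \<partial>(N \<bind> K')) powr (1 / q)"
    by (simp add: mult.assoc)
qed

lemma renyi_dominated_return: "renyi_dominated 1 q (return S x) (return S x)" if "x \<in> space S" "0 < q"
  using that by (auto simp: renyi_dominated_def integral_return powr_powr)

text \<open>Testing with the indicator of \<open>E\<close> gives
  \<open>measure M E <= m powr (1 - 1 / l)\<close>, where \<open>m\<close> is \<open>exp a\<close>
  times the mass of \<open>E\<close> under \<open>N\<close>. Either this is at most \<delta>, or
  \<open>m\<close> is large enough for the factor \<open>m powr (- (1 / l))\<close> to be absorbed
  into the exponential.\<close>

lemma renyi_dominated_approx_DP:
  assumes dom: "renyi_dominated (exp ((l - 1) / l * a)) (l / (l - 1)) M N"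
    and E: "E \<in> sets M" "sets N = sets M" and l: "1 < l" and \<delta>: "0 < \<delta>"
    and fin: "finite_measure M" "finite_measure N"
  shows "measure M E \<le> exp (a + ln (1 / \<delta>) / (l - 1)) * measure N E + \<delta>"
proof -
  interpret M: finite_measure M by fact
  interpret N: finite_measure N by fact
  define q where "q = l / (l - 1)"
  have q: "0 < q" "1 / q = 1 - 1 / l" "(l - 1) / l = 1 - 1 / l" using l by (auto simp: q_def field_simps)
  define m where "m = exp a * measure N E"
  have "measure M E = (\<integral>x. indicator E x \<partial>M)" using E by simp
  also have "\<dots> \<le> exp ((l - 1) / l * a) * (\<integral>x. indicator E x powr q \<partial>N) powr (1 / q)"
    using E by (intro renyi_dominatedD[OF dom[folded q_def]]) auto
  also have "(\<lambda>x. indicator E x powr q) = (indicator E :: _ \<Rightarrow> real)"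
    using q by (auto simp: indicator_def)
  also have "(\<integral>x. indicator E x \<partial>N) = measure N E" using E by simp
  also have "exp ((l - 1) / l * a) * measure N E powr (1 / q) = m powr (1 - 1 / l)"
    unfolding m_def q by (simp add: powr_mult exp_powr_real mult.commute)
  finally have le: "measure M E \<le> m powr (1 - 1 / l)" .
  show ?thesis
  \<comment> \<open>The threshold solves \<open>m powr (1 - 1 / l) = \<delta>\<close>.\<close>
  proof (cases "m \<le> \<delta> powr (l / (l - 1))")
    case True
    then have "m powr (1 - 1 / l) \<le> (\<delta> powr (l / (l - 1))) powr (1 - 1 / l)"
      using l by (intro powr_mono2) (auto simp: m_def)
    also have "\<dots> = \<delta>" using l \<delta> by (simp add: powr_powr field_simps)
    finally show ?thesis using le by (simp add: add_increasing)
  next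
    case False
    then have m: "\<delta> powr (l / (l - 1)) \<le> m" "0 < m" using \<delta> by (auto simp: not_le intro: le_less_trans[rotated])
    have "m powr (1 - 1 / l) = m * m powr (- (1 / l))"
      using m by (simp add: powr_diff powr_minus_divide)
    also have "\<dots> \<le> m * (\<delta> powr (l / (l - 1))) powr (- (1 / l))"
      using m \<delta> l by (intro mult_left_mono powr_mono2') auto
    also have "(\<delta> powr (l / (l - 1))) powr (- (1 / l)) = exp (ln (1 / \<delta>) / (l - 1))"
      using \<delta> l by (simp add: powr_powr) (simp add: powr_def ln_div field_simps)
    also have "m * exp (ln (1 / \<delta>) / (l - 1)) = exp (a + ln (1 / \<delta>) / (l - 1)) * measure N E"
      by (simp add: m_def exp_add)
    finally show ?thesis using le \<delta> by linarith
  qed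
qed

section \<open>Mixtures of shifted Gaussians\<close>

text \<open>Expanding the square leaves three product moments. Keeping the negative cross term is
  what yields \<open>exp x - exp (x / 2)\<close>, a quantity of order \<open>x\<close>. The
  existential form carries integrability and the bound together through later averages.\<close>

lemma has_bochner_integral_gauss_lr_chi_square:
  fixes a a' m :: "'a::euclidean_space"
  assumes s2: "0 < s2"
    and dist: "(norm (a - m))\<^sup>2 \<le> x * s2" "(norm (a' - m))\<^sup>2 \<le> x * s2" "(norm (a - a'))\<^sup>2 \<le> x * s2"
  shows "\<exists>d. has_bochner_integral (gauss_vec s2)
      (\<lambda>b. (gauss_lr s2 a b - gauss_lr s2 a' b)\<^sup>2 / gauss_lr s2 m b) d \<and> d \<le> 2 * (exp x - exp (x / 2))"
proof (intro exI conjI)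
  let ?L = "gauss_lr s2"
  let ?d = "\<lambda>u v :: 'a. exp (((u - m) \<bullet> (v - m)) / s2)"
  have "has_bochner_integral (gauss_vec s2)
     (\<lambda>b. ?L a b * ?L a b / ?L m b + ?L a' b * ?L a' b / ?L m b - 2 * (?L a b * ?L a' b / ?L m b))
     (?d a a + ?d a' a' - 2 * ?d a a')"
    by (intro has_bochner_integral_add has_bochner_integral_diff has_bochner_integral_mult_right gauss_lr_prod_moment s2)
  moreover have "?L a b * ?L a b / ?L m b + ?L a' b * ?L a' b / ?L m b - 2 * (?L a b * ?L a' b / ?L m b)
      = (?L a b - ?L a' b)\<^sup>2 / ?L m b" for b
    using gauss_lr_pos[of s2 m b] by (simp add: power2_eq_square field_simps)
  ultimately show "has_bochner_integral (gauss_vec s2) (\<lambda>b. (?L a b - ?L a' b)\<^sup>2 / ?L m b) (?d a a + ?d a' a' - 2 * ?d a a')"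
    by simp
  \<comment> \<open>Polarisation: the bound on the distance from \<open>a\<close> to
    \<open>a'\<close> bounds the inner product from below.\<close>
  have "(a - m) \<bullet> (a' - m) = ((a - m) \<bullet> (a - m) + (a' - m) \<bullet> (a' - m) - (a - a') \<bullet> (a - a')) / 2"
    by (simp add: inner_diff_left inner_diff_right inner_commute)
  then have "((a - m) \<bullet> (a - m) + (a' - m) \<bullet> (a' - m) - x * s2) / 2 / s2 \<le> (a - m) \<bullet> (a' - m) / s2"
    using s2 dist by (intro divide_right_mono) (auto simp: power2_norm_eq_inner)
  also have "((a - m) \<bullet> (a - m) + (a' - m) \<bullet> (a' - m) - x * s2) / 2 / s2 =
      ((a - m) \<bullet> (a - m) / s2 + (a' - m) \<bullet> (a' - m) / s2 - x) / 2"
    using s2 by (simp add: field_simps)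
  finally show "?d a a + ?d a' a' - 2 * ?d a a' \<le> 2 * (exp x - exp (x / 2))"
    using s2 dist by (intro exp_second_difference_le) (auto simp: power2_norm_eq_inner divide_le_eq)
qed

text \<open>The density, relative to \<open>gauss_vec s2\<close>, of \<open>u i\<close> plus
  Gaussian noise with \<open>i\<close> uniform below \<open>n\<close>.\<close>

definition gauss_mix :: "real \<Rightarrow> nat \<Rightarrow> (nat \<Rightarrow> 'a::euclidean_space) \<Rightarrow> 'a \<Rightarrow> real" where
  "gauss_mix s2 n u b = (\<Sum>i<n. gauss_lr s2 (u i) b) / real n"

lemma gauss_mix_measurable [measurable]: "gauss_mix s2 n u \<in> borel_measurable borel"
  unfolding gauss_mix_def by measurable

lemma gauss_mix_pos: "0 < n \<Longrightarrow> 0 < gauss_mix s2 n u b"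
  unfolding gauss_mix_def by (intro divide_pos_pos sum_pos) (auto simp: gauss_lr_pos)

lemma gauss_mix_powr_neg_le:
  assumes "0 < n" "0 \<le> s"
  shows "gauss_mix s2 n u b powr (- s) \<le> (\<Sum>i<n. gauss_lr s2 (u i) b powr (- s)) / real n"
  using powr_neg_mean_le[of "{..<n}" s "\<lambda>i. gauss_lr s2 (u i) b"] assms
  by (auto simp: gauss_mix_def gauss_lr_pos)

lemma has_bochner_integral_mean:
  fixes f :: "nat \<Rightarrow> 'a \<Rightarrow> real"
  assumes "\<And>i. i < n \<Longrightarrow> \<exists>d. has_bochner_integral M (f i) d \<and> d \<le> c" "0 < n"
  shows "\<exists>d. has_bochner_integral M (\<lambda>b. (\<Sum>i<n. f i b) / real n) d \<and> d \<le> c"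
proof -
  obtain d where d: "\<And>i. i < n \<Longrightarrow> has_bochner_integral M (f i) (d i) \<and> d i \<le> c"
    using assms(1) by metis
  have "has_bochner_integral M (\<lambda>b. (\<Sum>i<n. f i b) / real n) ((\<Sum>i<n. d i) / real n)"
    using d by (intro has_bochner_integral_divide_zero has_bochner_integral_sum) auto
  moreover have "(\<Sum>i<n. d i) \<le> (\<Sum>i<n. c)"
    using d by (intro sum_mono) auto
  ultimately show ?thesis using assms(2) by (auto simp: field_simps)
qed

text \<open>Integrates the pointwise majorant, with the negative powers of the mixture
  \<open>Q\<close> replaced by averages over its components. Each resulting term compares Gaussians
  whose centres are at most \<open>2 * G\<close> apart, hence
  \<open>x = 4 * G^2 / s2\<close>.\<close>

lemma gauss_mix_renyi_moment:
  fixes u v :: "nat \<Rightarrow> 'a::euclidean_space"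
  assumes n: "0 < n" and j: "j < n" and uv: "\<And>i. i < n \<Longrightarrow> i \<noteq> j \<Longrightarrow> u i = v i"
    and bd: "\<And>i. i < n \<Longrightarrow> norm (u i) \<le> G" "\<And>i. i < n \<Longrightarrow> norm (v i) \<le> G"
    and s2: "0 < s2" and G: "0 < G" and x_def: "x = 4 * G\<^sup>2 / s2" and x: "x \<le> 1 / 0.67" and l: "1 < l"
    and p: "1 / real n \<le> exp (- 1.5 * (l - 1) * x) / (l * (1 + 1 / x))"
  shows "integrable (gauss_vec s2) (\<lambda>b. gauss_mix s2 n u b powr l * gauss_mix s2 n v b powr (1 - l))" (is ?int)
    and "(\<integral>b. gauss_mix s2 n u b powr l * gauss_mix s2 n v b powr (1 - l) \<partial>gauss_vec s2)
      \<le> 1 + 7 / 2 * l * (l - 1) * x / (real n)\<^sup>2" (is ?le)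
proof -
  have x0: "0 < x" using s2 G by (simp add: x_def)
  have "?int \<and> ?le"
  proof (rule obtain_moment_majorant[OF l])
    fix C1 C2 \<kappa> :: real
    assume \<kappa>: "1 \<le> \<kappa>" and C: "0 \<le> C1" "0 \<le> C2" and
      point: "\<And>A B Q p. \<lbrakk>0 < A; 0 < B; 0 < Q; 0 < p; 0 < Q + p * (A - B)\<rbrakk> \<Longrightarrow>
         (Q + p * (A - B)) powr l * Q powr (1 - l) \<le> Q + l * p * (A - B) + l * (l - 1) / 2 * p\<^sup>2 *
          (C1 * ((A - B)\<^sup>2 / Q) + C2 * p powr \<kappa> * ((A powr (\<kappa> + 2) + B powr (\<kappa> + 2)) * Q powr (- (\<kappa> + 1))))" and
      num: "\<And>x p. \<lbrakk>0 < x; x \<le> 1 / 0.67; 0 < p; p \<le> exp (- 1.5 * (l - 1) * x) / (l * (1 + 1 / x))\<rbrakk>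
         \<Longrightarrow> C1 * (3.2 * x) + C2 * (p powr \<kappa> * (2 * exp ((\<kappa> + 1) * (\<kappa> + 2) * x / 2))) \<le> 7 * x"
    let ?M = "gauss_vec s2 :: 'a measure"
    let ?L = "gauss_lr s2"
    define q where "q = 1 / real n"
    have q0: "0 < q" using n by (simp add: q_def)
    define A B P Q where "A = ?L (u j)" and "B = ?L (v j)" and "P = gauss_mix s2 n u" and "Q = gauss_mix s2 n v"
    note defs = A_def B_def P_def Q_def
    have pos: "0 < A b" "0 < B b" "0 < P b" "0 < Q b" for b
      using n by (auto simp: defs gauss_lr_pos gauss_mix_pos)
    have P: "P b = Q b + q * (A b - B b)" for b
    proof -
      have "(\<Sum>i<n. ?L (u i) b) = ?L (u j) b + (\<Sum>i\<in>{..<n} - {j}. ?L (u i) b)"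
        using j by (intro sum.remove) auto
      also have "(\<Sum>i\<in>{..<n} - {j}. ?L (u i) b) = (\<Sum>i\<in>{..<n} - {j}. ?L (v i) b)"
        using uv by (intro sum.cong) auto
      also have "\<dots> = (\<Sum>i<n. ?L (v i) b) - ?L (v j) b"
        using j sum.remove[of "{..<n}" j "\<lambda>i. ?L (v i) b"] by simp
      finally have "(\<Sum>i<n. ?L (u i) b) = (\<Sum>i<n. ?L (v i) b) + (?L (u j) b - ?L (v j) b)" by simp
      then show ?thesis by (simp add: defs gauss_mix_def q_def add_divide_distrib)
    qed
    have dist: "(norm (a - m))\<^sup>2 \<le> x * s2" if "norm a \<le> G" "norm m \<le> G" for a m :: 'a
    proof -
      have "(norm (a - m))\<^sup>2 \<le> (2 * G)\<^sup>2"
        using norm_triangle_ineq4[of a m] that by (intro power_mono) auto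
      then show ?thesis using s2 by (simp add: x_def power_mult_distrib)
    qed
    have mom: "\<exists>d. has_bochner_integral ?M (\<lambda>b. ?L a b powr (\<kappa> + 2) * ?L m b powr (- (\<kappa> + 1))) d
        \<and> d \<le> exp ((\<kappa> + 1) * (\<kappa> + 2) * x / 2)" if "norm a \<le> G" "norm m \<le> G" for a m
    proof (intro exI conjI)
      have \<kappa>2: "\<kappa> + 2 = \<kappa> + 1 + 1" by simp
      show "has_bochner_integral ?M (\<lambda>b. ?L a b powr (\<kappa> + 2) * ?L m b powr (- (\<kappa> + 1)))
          (exp ((\<kappa> + 1) * (\<kappa> + 1 + 1) * (norm (a - m))\<^sup>2 / (2 * s2)))"
        unfolding \<kappa>2 by (rule gauss_lr_powr_moment[OF s2])
      have "(\<kappa> + 1) * (\<kappa> + 2) * (norm (a - m))\<^sup>2 \<le> (\<kappa> + 1) * (\<kappa> + 2) * (x * s2)"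
        using dist[OF that] \<kappa> by (intro mult_left_mono) auto
      then show "exp ((\<kappa> + 1) * (\<kappa> + 1 + 1) * (norm (a - m))\<^sup>2 / (2 * s2)) \<le> exp ((\<kappa> + 1) * (\<kappa> + 2) * x / 2)"
        using s2 by (simp add: field_simps)
    qed
    \<comment> \<open>\<open>D\<close> and \<open>E\<close> are these averages for the chi-square
      part and for the growth part.\<close>
    define D where "D b = (\<Sum>i<n. (A b - B b)\<^sup>2 / ?L (v i) b) / real n" for b
    define E where "E b = (\<Sum>i<n. (A b powr (\<kappa> + 2) * ?L (v i) b powr (- (\<kappa> + 1)) +
        B b powr (\<kappa> + 2) * ?L (v i) b powr (- (\<kappa> + 1)))) / real n" for b
    have "2 * (exp x - exp (x / 2)) \<le> 3.2 * x"
      using exp_minus_exp_half_le[of x] x x0 by simp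
    then have "\<exists>d. has_bochner_integral ?M D d \<and> d \<le> 3.2 * x"
      unfolding D_def A_def B_def
      using has_bochner_integral_gauss_lr_chi_square[OF s2 dist dist dist] bd j n
      by (intro has_bochner_integral_mean) (meson order_trans)+
    then obtain d where d: "has_bochner_integral ?M D d" "d \<le> 3.2 * x" by blast
    have "\<exists>d. has_bochner_integral ?M E d \<and> d \<le> 2 * exp ((\<kappa> + 1) * (\<kappa> + 2) * x / 2)"
      unfolding E_def
    proof (rule has_bochner_integral_mean[OF _ n])
      fix i assume i: "i < n"
      obtain d1 where d1: "has_bochner_integral ?M (\<lambda>b. A b powr (\<kappa> + 2) * ?L (v i) b powr (- (\<kappa> + 1))) d1"
          "d1 \<le> exp ((\<kappa> + 1) * (\<kappa> + 2) * x / 2)"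
        using mom[OF bd(1)[OF j] bd(2)[OF i]] unfolding A_def by blast
      obtain d2 where d2: "has_bochner_integral ?M (\<lambda>b. B b powr (\<kappa> + 2) * ?L (v i) b powr (- (\<kappa> + 1))) d2"
          "d2 \<le> exp ((\<kappa> + 1) * (\<kappa> + 2) * x / 2)"
        using mom[OF bd(2)[OF j] bd(2)[OF i]] unfolding B_def by blast
      show "\<exists>d. has_bochner_integral ?M (\<lambda>b. A b powr (\<kappa> + 2) * ?L (v i) b powr (- (\<kappa> + 1)) +
          B b powr (\<kappa> + 2) * ?L (v i) b powr (- (\<kappa> + 1))) d \<and> d \<le> 2 * exp ((\<kappa> + 1) * (\<kappa> + 2) * x / 2)"
        using has_bochner_integral_add[OF d1(1) d2(1)] d1(2) d2(2) by (intro exI[of _ "d1 + d2"]) auto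
    qed
    then obtain e where e: "has_bochner_integral ?M E e" "e \<le> 2 * exp ((\<kappa> + 1) * (\<kappa> + 2) * x / 2)" by blast
    have hQ: "has_bochner_integral ?M Q 1"
    proof -
      have "has_bochner_integral ?M (\<lambda>b. (\<Sum>i<n. ?L (v i) b) / real n) ((\<Sum>i<n. 1) / real n)"
        by (intro has_bochner_integral_divide_zero has_bochner_integral_sum has_bochner_integral_gauss_lr s2)
      then show ?thesis using n by (simp add: Q_def gauss_mix_def[abs_def])
    qed
    define U where "U b = Q b + l * q * (A b - B b) + l * (l - 1) / 2 * q\<^sup>2 * (C1 * D b + C2 * q powr \<kappa> * E b)" for b
    \<comment> \<open>The first-order term has mean \<open>1 - 1\<close>, since \<open>A\<close> and
      \<open>B\<close> both integrate to 1; only second-order terms survive, which gives the factor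
      of order one over \<open>n\<close> squared.\<close>
    define U' where "U' = 1 + l * q * (1 - 1) + l * (l - 1) / 2 * q\<^sup>2 * (C1 * d + C2 * q powr \<kappa> * e)"
    have U: "has_bochner_integral ?M U U'"
      unfolding U_def U'_def A_def B_def
      by (intro has_bochner_integral_add has_bochner_integral_diff has_bochner_integral_mult_right
          has_bochner_integral_gauss_lr hQ d e s2)
    have le: "P b powr l * Q b powr (1 - l) \<le> U b" for b
    proof -
      have "Q b powr - 1 \<le> (\<Sum>i<n. ?L (v i) b powr - 1) / real n"
        unfolding Q_def using n by (intro gauss_mix_powr_neg_le) auto
      then have "(A b - B b)\<^sup>2 * Q b powr - 1 \<le> (A b - B b)\<^sup>2 * ((\<Sum>i<n. ?L (v i) b powr - 1) / real n)"
        by (intro mult_left_mono) auto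
      then have D: "(A b - B b)\<^sup>2 / Q b \<le> D b"
        using pos(4)[of b] gauss_lr_pos[of s2 _ b]
        by (simp add: D_def powr_minus divide_inverse sum_distrib_left less_imp_le mult_ac)
      have "(A b powr (\<kappa> + 2) + B b powr (\<kappa> + 2)) * Q b powr (- (\<kappa> + 1)) \<le>
         (A b powr (\<kappa> + 2) + B b powr (\<kappa> + 2)) * ((\<Sum>i<n. ?L (v i) b powr (- (\<kappa> + 1))) / real n)"
        unfolding Q_def using n \<kappa> by (intro mult_left_mono gauss_mix_powr_neg_le) auto
      also have "\<dots> = E b"
        by (simp only: E_def sum_distrib_left times_divide_eq_right distrib_right sum.distrib)
      finally have E: "(A b powr (\<kappa> + 2) + B b powr (\<kappa> + 2)) * Q b powr (- (\<kappa> + 1)) \<le> E b" .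
      have "P b powr l * Q b powr (1 - l) \<le> Q b + l * q * (A b - B b) + l * (l - 1) / 2 * q\<^sup>2 *
          (C1 * ((A b - B b)\<^sup>2 / Q b) + C2 * q powr \<kappa> * ((A b powr (\<kappa> + 2) + B b powr (\<kappa> + 2)) * Q b powr (- (\<kappa> + 1))))"
        using pos[of b] q0 unfolding P by (intro point)
      also have "\<dots> \<le> U b"
        unfolding U_def using C q0 l D E by (intro add_left_mono mult_left_mono add_mono) auto
      finally show ?thesis .
    qed
    have meas: "(\<lambda>b. P b powr l * Q b powr (1 - l)) \<in> borel_measurable ?M"
      unfolding P_def Q_def by measurable
    have int: "integrable ?M (\<lambda>b. P b powr l * Q b powr (1 - l))"
    proof (rule Bochner_Integration.integrable_bound[OF integrable.intros[OF U] meas])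
      show "AE b in ?M. norm (P b powr l * Q b powr (1 - l)) \<le> norm (U b)"
        by (intro AE_I2) (simp add: order_trans[OF le abs_ge_self])
    qed
    have "(\<integral>b. P b powr l * Q b powr (1 - l) \<partial>?M) \<le> (\<integral>b. U b \<partial>?M)"
      by (rule integral_mono[OF int integrable.intros[OF U] le])
    also have "\<dots> = U'"
      using U by (rule has_bochner_integral_integral_eq)
    also have "\<dots> \<le> 1 + l * (l - 1) / 2 * q\<^sup>2 * (7 * x)"
    proof -
      have "C1 * d + C2 * q powr \<kappa> * e \<le> C1 * (3.2 * x) + C2 * q powr \<kappa> * (2 * exp ((\<kappa> + 1) * (\<kappa> + 2) * x / 2))"
        using d(2) e(2) C by (intro add_mono mult_left_mono) auto
      also have "\<dots> \<le> 7 * x"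
        using num[OF x0 x q0] p by (simp add: q_def mult.assoc)
      finally have "l * (l - 1) / 2 * q\<^sup>2 * (C1 * d + C2 * q powr \<kappa> * e) \<le> l * (l - 1) / 2 * q\<^sup>2 * (7 * x)"
        using l by (intro mult_left_mono) auto
      then show ?thesis by (simp add: U'_def)
    qed
    also have "\<dots> = 1 + 7 / 2 * l * (l - 1) * x / (real n)\<^sup>2"
      by (simp add: q_def power_divide)
    finally show "?int \<and> ?le" using int by (simp only: P_def Q_def)
  qed
  then show ?int and ?le by auto
qed

text \<open>Rewrites sampling an index and adding noise as a reweighting of the centred Gaussian;
  boundedness of \<open>h\<close> supplies integrability.\<close>

lemma gauss_mix_integral:
  fixes h :: "'a::euclidean_space \<Rightarrow> real"
  assumes s2: "0 < s2" and [measurable]: "h \<in> borel_measurable borel" and h: "\<And>y. 0 \<le> h y" "\<And>y. h y \<le> 1"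
  shows "has_bochner_integral (gauss_vec s2) (\<lambda>b. gauss_mix s2 n u b * h b)
    ((\<Sum>i<n. \<integral>b. h (u i + b) \<partial>gauss_vec s2) / real n)"
proof -
  have "has_bochner_integral (gauss_vec s2) (\<lambda>b. gauss_lr s2 m b * h b) (\<integral>b. h (m + b) \<partial>gauss_vec s2)" for m
    unfolding integral_gauss_vec_shift[OF s2 assms(2)]
  proof (rule has_bochner_integral_integrable)
    have "integrable (gauss_vec s2) (gauss_lr s2 m)"
      using has_bochner_integral_gauss_lr[OF s2] by (rule integrable.intros)
    then show "integrable (gauss_vec s2) (\<lambda>b. gauss_lr s2 m b * h b)"
    proof (rule Bochner_Integration.integrable_bound)
      show "AE b in gauss_vec s2. norm (gauss_lr s2 m b * h b) \<le> norm (gauss_lr s2 m b)"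
        using h gauss_lr_pos[of s2 m] by (intro AE_I2) (auto simp: abs_mult mult_left_le less_imp_le)
    qed measurable
  qed
  then have "has_bochner_integral (gauss_vec s2) (\<lambda>b. (\<Sum>i<n. gauss_lr s2 (u i) b * h b) / real n)
    ((\<Sum>i<n. \<integral>b. h (u i + b) \<partial>gauss_vec s2) / real n)"
    by (intro has_bochner_integral_divide_zero has_bochner_integral_sum)
  then show ?thesis
    by (simp add: gauss_mix_def[abs_def] sum_distrib_right)
qed

text \<open>Hoelder's inequality for the factorisation of \<open>P * h\<close> into
  \<open>h * Q powr (1 / q)\<close> and \<open>P * Q powr (- (1 / q))\<close>. The
  \<open>l\<close>-th power of the second factor is the integrand of the Renyi moment, and
  \<open>1 + y <= exp y\<close> makes its bound multiplicative.\<close>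

lemma gauss_mix_renyi_dominated:
  fixes u v :: "nat \<Rightarrow> 'a::euclidean_space" and h :: "'a \<Rightarrow> real"
  assumes n: "0 < n" and j: "j < n" and uv: "\<And>i. i < n \<Longrightarrow> i \<noteq> j \<Longrightarrow> u i = v i"
    and bd: "\<And>i. i < n \<Longrightarrow> norm (u i) \<le> G" "\<And>i. i < n \<Longrightarrow> norm (v i) \<le> G"
    and s2: "0 < s2" and G: "0 < G" and x: "x = 4 * G\<^sup>2 / s2" "x \<le> 1 / 0.67" and l: "1 < l"
    and p: "1 / real n \<le> exp (- 1.5 * (l - 1) * x) / (l * (1 + 1 / x))"
    and hm [measurable]: "h \<in> borel_measurable borel" and h: "\<And>y. 0 \<le> h y" "\<And>y. h y \<le> 1"
    and q: "q = l / (l - 1)"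
  shows "(\<Sum>i<n. \<integral>b. h (u i + b) \<partial>gauss_vec s2) / real n \<le> exp ((l - 1) / l * (7 / 2 * l * x / (real n)\<^sup>2)) *
    ((\<Sum>i<n. \<integral>b. h (v i + b) powr q \<partial>gauss_vec s2) / real n) powr (1 / q)"
proof -
  let ?M = "gauss_vec s2 :: 'a measure"
  define P Q where "P = gauss_mix s2 n u" and "Q = gauss_mix s2 n v"
  have [measurable]: "P \<in> borel_measurable borel" "Q \<in> borel_measurable borel" by (auto simp: P_def Q_def)
  have pos: "0 < P b" "0 < Q b" for b using n by (auto simp: P_def Q_def gauss_mix_pos)
  have q1: "1 < q" "1 / q + 1 / l = 1" "1 / q * l = l - 1" using l by (auto simp: q field_simps)
  define F where "F b = h b * Q b powr (1 / q)" for b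
  define K where "K b = P b * Q b powr (- (1 / q))" for b
  have Fq: "F b powr q = Q b * h b powr q" for b
    using q1 h pos(2)[of b] by (simp add: F_def powr_mult powr_powr)
  have Kl: "K b powr l = P b powr l * Q b powr (1 - l)" for b
    using q1(3) pos by (simp add: K_def powr_mult powr_powr)
  have hq: "has_bochner_integral ?M (\<lambda>b. Q b * h b powr q)
     ((\<Sum>i<n. \<integral>b. h (v i + b) powr q \<partial>?M) / real n)"
    unfolding Q_def using h q1 by (intro gauss_mix_integral s2) (auto intro: powr_le1)
  note mom = gauss_mix_renyi_moment[where u = u and v = v, OF n j uv bd s2 G x l p, folded P_def Q_def]
  have "(\<Sum>i<n. \<integral>b. h (u i + b) \<partial>?M) / real n = (\<integral>b. P b * h b \<partial>?M)"
    unfolding P_def by (rule has_bochner_integral_integral_eq[OF gauss_mix_integral[OF s2 hm h], symmetric])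
  also have "\<dots> = (\<integral>b. F b * K b \<partial>?M)"
  proof -
    have "P b * h b = F b * K b" for b
      using pos(2)[of b] by (simp add: F_def K_def powr_minus_divide)
    then show ?thesis by simp
  qed
  also have "\<dots> \<le> (\<integral>b. F b powr q \<partial>?M) powr (1 / q) * (\<integral>b. K b powr l \<partial>?M) powr (1 / l)"
  proof (rule integral_mult_le_Hoelder[OF q1(1) l q1(2)])
    show "integrable ?M (\<lambda>b. F b powr q)" unfolding Fq using hq by (rule integrable.intros)
    show "integrable ?M (\<lambda>b. K b powr l)" unfolding Kl using mom(1) .
    show "0 \<le> F b" "0 \<le> K b" for b using h pos[of b] by (auto simp: F_def K_def)
  qed (auto simp: F_def[abs_def] K_def[abs_def])
  also have "\<dots> \<le> (\<integral>b. F b powr q \<partial>?M) powr (1 / q) * exp ((l - 1) / l * (7 / 2 * l * x / (real n)\<^sup>2))"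
  proof (rule mult_left_mono)
    have "(\<integral>b. K b powr l \<partial>?M) \<le> exp (7 / 2 * l * (l - 1) * x / (real n)\<^sup>2)"
      unfolding Kl using mom(2) exp_ge_add_one_self by (rule order_trans)
    then have "(\<integral>b. K b powr l \<partial>?M) powr (1 / l) \<le> exp (7 / 2 * l * (l - 1) * x / (real n)\<^sup>2) powr (1 / l)"
      using l by (intro powr_mono2) auto
    also have "\<dots> = exp ((l - 1) / l * (7 / 2 * l * x / (real n)\<^sup>2))"
      using l by (simp add: exp_powr_real mult_ac)
    finally show "(\<integral>b. K b powr l \<partial>?M) powr (1 / l) \<le> exp ((l - 1) / l * (7 / 2 * l * x / (real n)\<^sup>2))" .
  qed simp
  also have "(\<integral>b. F b powr q \<partial>?M) = (\<Sum>i<n. \<integral>b. h (v i + b) powr q \<partial>?M) / real n"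
    unfolding Fq using hq by (rule has_bochner_integral_integral_eq)
  finally show ?thesis by (simp only: mult.commute)
qed

section \<open>Noisy projected gradient descent\<close>

lemma dpsgd_step_measurable:
  fixes g :: "'a::euclidean_space \<Rightarrow> 'z \<Rightarrow> 'a"
  assumes W: "convex W" "closed W" "W \<noteq> {}" and g: "\<And>z. (\<lambda>w. g w z) \<in> borel_measurable borel" and s2: "0 < s2"
  shows "dpsgd_step g W S \<eta> s2 t \<in> borel \<rightarrow>\<^sub>M prob_algebra borel"
proof -
  have [measurable]: "closest_point W \<in> borel_measurable borel"
    by (intro borel_measurable_continuous_onI continuous_on_closest_point W)
  have gS [measurable]: "(\<lambda>(x, i). g (fst x) (S ! i)) \<in> borel_measurable ((borel :: ('a \<times> 'a) measure) \<Otimes>\<^sub>M count_space UNIV)"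
  \<comment> \<open>Joint measurability in state and index reduces to each fixed index, since there
    are countably many.\<close>
  proof (rule measurable_compose_countable'[where I=UNIV and g=snd and f="\<lambda>i x. g (fst (fst x)) (S ! i)", THEN measurable_cong[THEN iffD1, rotated]])
    fix i
    show "(\<lambda>x. g (fst (fst x)) (S ! i)) \<in> borel_measurable ((borel :: ('a \<times> 'a) measure) \<Otimes>\<^sub>M count_space (UNIV :: nat set))"
      by (rule measurable_compose[OF _ g]) (simp add: borel_prod[symmetric])
  qed (auto simp: case_prod_beta)
  have "(\<lambda>x. measure_pmf (pmf_of_set {..<length S}) \<bind> (\<lambda>i. distr (gauss_vec s2) borel
         (\<lambda>b. (closest_point W (fst x - \<eta> t *\<^sub>R (g (fst x) (S ! i) + b)), snd x + fst x))))
      \<in> (borel :: ('a \<times> 'a) measure) \<rightarrow>\<^sub>M prob_algebra borel"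
  proof (rule measurable_bind_prob_space2[where N="count_space UNIV"])
    show "(\<lambda>x. measure_pmf (pmf_of_set {..<length S})) \<in> (borel :: ('a \<times> 'a) measure) \<rightarrow>\<^sub>M prob_algebra (count_space UNIV)"
      by (rule measurable_const) (auto simp: space_prob_algebra prob_space_measure_pmf)
    show "(\<lambda>(x, i). distr (gauss_vec s2) borel
         (\<lambda>b. (closest_point W (fst x - \<eta> t *\<^sub>R (g (fst x) (S ! i) + b)), snd x + fst x)))
      \<in> (borel :: ('a \<times> 'a) measure) \<Otimes>\<^sub>M count_space UNIV \<rightarrow>\<^sub>M prob_algebra borel"
      unfolding case_prod_beta
    proof (rule measurable_distr_prob_space2[where M=borel])
      show "(\<lambda>x. gauss_vec s2) \<in> (borel :: ('a \<times> 'a) measure) \<Otimes>\<^sub>M count_space (UNIV :: nat set) \<rightarrow>\<^sub>M prob_algebra borel"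
        using prob_space_gauss_vec[OF s2] by (intro measurable_const) (auto simp: space_prob_algebra)
      have fs: "fst \<in> (borel :: ('a \<times> 'a) measure) \<rightarrow>\<^sub>M (borel :: 'a measure)"
          "snd \<in> (borel :: ('a \<times> 'a) measure) \<rightarrow>\<^sub>M (borel :: 'a measure)"
        by (simp_all add: borel_prod[symmetric])
      note ff = measurable_compose[OF measurable_fst measurable_fst]
      have [measurable]:
          "(\<lambda>x. fst (fst (fst x))) \<in> borel_measurable (((borel :: ('a \<times> 'a) measure) \<Otimes>\<^sub>M count_space (UNIV :: nat set)) \<Otimes>\<^sub>M (borel :: 'a measure))"
          "(\<lambda>x. snd (fst (fst x))) \<in> borel_measurable (((borel :: ('a \<times> 'a) measure) \<Otimes>\<^sub>M count_space (UNIV :: nat set)) \<Otimes>\<^sub>M (borel :: 'a measure))"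
        by (rule measurable_compose[OF ff fs(1)], rule measurable_compose[OF ff fs(2)])
      have [measurable]: "(\<lambda>x. g (fst (fst (fst x))) (S ! snd (fst x)))
          \<in> borel_measurable (((borel :: ('a \<times> 'a) measure) \<Otimes>\<^sub>M count_space UNIV) \<Otimes>\<^sub>M (borel :: 'a measure))"
        using measurable_compose[OF measurable_fst gS] by (simp add: case_prod_beta)
      show "(\<lambda>(x, b). (closest_point W (fst (fst x) - \<eta> t *\<^sub>R (g (fst (fst x)) (S ! snd x) + b)), snd (fst x) + fst (fst x)))
          \<in> ((borel :: ('a \<times> 'a) measure) \<Otimes>\<^sub>M count_space UNIV) \<Otimes>\<^sub>M (borel :: 'a measure) \<rightarrow>\<^sub>M borel"
        unfolding case_prod_beta by (intro borel_measurable_Pair) measurable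
    qed
  qed
  then show ?thesis
    by (simp add: dpsgd_step_def case_prod_beta)
qed

lemma integral_dpsgd_step:
  fixes g :: "'a::euclidean_space \<Rightarrow> 'z \<Rightarrow> 'a" and h :: "'a \<times> 'a \<Rightarrow> real"
  assumes W: "convex W" "closed W" "W \<noteq> {}" and s2: "0 < s2" and S: "S \<noteq> []"
    and hm [measurable]: "h \<in> borel_measurable borel" and h: "\<And>y. 0 \<le> h y" "\<And>y. h y \<le> 1"
  shows "(\<integral>y. h y \<partial>dpsgd_step g W S \<eta> s2 t (w, acc)) =
    (\<Sum>i<length S. \<integral>b. h (closest_point W (w - \<eta> t *\<^sub>R (g w (S ! i) + b)), acc + w) \<partial>gauss_vec s2) / real (length S)"
proof -
  interpret gauss: prob_space "gauss_vec s2 :: 'a measure" by (rule prob_space_gauss_vec[OF s2])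
  have [measurable]: "closest_point W \<in> borel_measurable borel"
    by (intro borel_measurable_continuous_onI continuous_on_closest_point W)
  have m [measurable]: "(\<lambda>b. (closest_point W (w - \<eta> t *\<^sub>R (g w z + b)), acc + w)) \<in> gauss_vec s2 \<rightarrow>\<^sub>M borel" for z
    unfolding borel_prod[symmetric] by measurable
  let ?D = "\<lambda>i. distr (gauss_vec s2) borel (\<lambda>b. (closest_point W (w - \<eta> t *\<^sub>R (g w (S ! i) + b)), acc + w))"
  have D: "prob_space (?D i)" for i by (intro gauss.prob_space_distr m)
  have "(\<integral>y. h y \<partial>dpsgd_step g W S \<eta> s2 t (w, acc)) = (\<integral>i. \<integral>y. h y \<partial>?D i \<partial>measure_pmf (pmf_of_set {..<length S}))"
    unfolding dpsgd_step_def split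
  proof (rule integral_bind[where K=borel and B=1 and B'=1])
    show "?D \<in> measure_pmf (pmf_of_set {..<length S}) \<rightarrow>\<^sub>M subprob_algebra borel"
      using D by (auto simp: space_subprob_algebra prob_space_imp_subprob_space)
    show "AE i in measure_pmf (pmf_of_set {..<length S}). emeasure (?D i) (space (?D i)) \<le> ennreal 1"
      using prob_space.emeasure_space_1[OF D] by simp
  qed (use h in \<open>auto simp: measure_pmf.finite_measure_axioms\<close>)
  also have "\<dots> = (\<Sum>i<length S. \<integral>y. h y \<partial>?D i) / real (length S)"
    using S by (subst integral_pmf_of_set) auto
  finally show ?thesis by (simp add: integral_distr)
qed

text \<open>Post-processing: from a given state \<open>y\<close>, scaling, projection and
  accumulation are the same map for both datasets. Composing the test function with that map reduces
  the claim to the two mixtures of noisy gradients.\<close>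

lemma dpsgd_step_renyi_dominated:
  fixes g :: "'a::euclidean_space \<Rightarrow> 'z \<Rightarrow> 'a"
  assumes W: "convex W" "closed W" "W \<noteq> {}" and g: "\<And>z w. norm (g w z) \<le> G"
    and len: "length S = n" "length S' = n" and j: "j < n" and S: "\<And>i. i < n \<Longrightarrow> i \<noteq> j \<Longrightarrow> S ! i = S' ! i"
    and s2: "0 < s2" and G: "0 < G" and x: "x = 4 * G\<^sup>2 / s2" "x \<le> 1 / 0.67" and l: "1 < l"
    and p: "1 / real n \<le> exp (- 1.5 * (l - 1) * x) / (l * (1 + 1 / x))"
  shows "renyi_dominated (exp ((l - 1) / l * (7 / 2 * l * x / (real n)\<^sup>2))) (l / (l - 1))
    (dpsgd_step g W S \<eta> s2 t y) (dpsgd_step g W S' \<eta> s2 t y)"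
proof -
  obtain w acc where y: "y = (w, acc)" by (cases y)
  have [measurable]: "closest_point W \<in> borel_measurable borel"
    by (intro borel_measurable_continuous_onI continuous_on_closest_point W)
  have n: "0 < n" "S \<noteq> []" "S' \<noteq> []" using j len by auto
  have sets: "sets (dpsgd_step g W S \<eta> s2 t y) = sets borel"
    by (simp add: dpsgd_step_def y sets_bind[where N=borel])
  show ?thesis
    unfolding renyi_dominated_def
  proof (intro ballI impI)
    fix h :: "'a \<times> 'a \<Rightarrow> real"
    assume "h \<in> borel_measurable (dpsgd_step g W S \<eta> s2 t y)" and h: "\<forall>x. 0 \<le> h x \<and> h x \<le> 1"
    then have [measurable]: "h \<in> borel_measurable borel"
      by (simp add: measurable_cong_sets[OF sets refl])
    define k where "k b = h (closest_point W (w - \<eta> t *\<^sub>R b), acc + w)" for b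
    have [measurable]: "(\<lambda>b. (closest_point W (w - \<eta> t *\<^sub>R b), acc + w)) \<in> borel_measurable borel"
      unfolding borel_prod[symmetric] by measurable
    have km: "k \<in> borel_measurable borel"
      unfolding k_def by measurable
    define q where "q = l / (l - 1)"
    have q: "0 < q" using l by (simp add: q_def)
    have "(\<integral>x. h x \<partial>dpsgd_step g W S \<eta> s2 t y) = (\<Sum>i<n. \<integral>b. k (g w (S ! i) + b) \<partial>gauss_vec s2) / real n"
      using h unfolding y k_def len(1)[symmetric] by (intro integral_dpsgd_step W s2 n) auto
    also have "\<dots> \<le> exp ((l - 1) / l * (7 / 2 * l * x / (real n)\<^sup>2)) *
        ((\<Sum>i<n. \<integral>b. k (g w (S' ! i) + b) powr q \<partial>gauss_vec s2) / real n) powr (1 / q)"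
      using h S
      by (intro gauss_mix_renyi_dominated[OF n(1) j _ g g s2 G x l p km _ _ q_def]) (auto simp: k_def)
    also have "(\<Sum>i<n. \<integral>b. k (g w (S' ! i) + b) powr q \<partial>gauss_vec s2) / real n
        = (\<integral>x. h x powr q \<partial>dpsgd_step g W S' \<eta> s2 t y)"
      using h q unfolding y k_def len(2)[symmetric]
      by (intro integral_dpsgd_step[symmetric] W s2 n) (auto intro: powr_le1)
    finally show "(\<integral>x. h x \<partial>dpsgd_step g W S \<eta> s2 t y) \<le> exp ((l - 1) / l * (7 / 2 * l * x / (real n)\<^sup>2)) *
        (\<integral>x. h x powr (l / (l - 1)) \<partial>dpsgd_step g W S' \<eta> s2 t y) powr (1 / (l / (l - 1)))"
      unfolding q_def .
  qed
qed

lemma dpsgd_run_prob_space: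
  assumes "\<And>t. dpsgd_step g W S \<eta> s2 t \<in> borel \<rightarrow>\<^sub>M prob_algebra borel"
  shows "prob_space (dpsgd_run g W S \<eta> s2 T) \<and> sets (dpsgd_run g W S \<eta> s2 T) = sets borel"
proof (induction T)
  case 0
  then show ?case by (simp add: prob_space_return)
next
  case (Suc T)
  let ?R = "dpsgd_run g W S \<eta> s2 T" and ?K = "dpsgd_step g W S \<eta> s2 (Suc T)"
  have "?R \<in> space (prob_algebra borel)" using Suc by (simp add: space_prob_algebra)
  \<comment> \<open>A fixed measure is treated as a kernel from a one-point space, so that the
    closure of probability kernels under \<open>bind\<close> applies.\<close>
  then have "(\<lambda>_. ?R \<bind> ?K) \<in> count_space {()} \<rightarrow>\<^sub>M prob_algebra borel"
    by (intro measurable_bind_prob_space[where N=borel] assms) auto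
  from measurable_space[OF this, of "()"] have "?R \<bind> ?K \<in> space (prob_algebra borel)" by simp
  then show ?case by (simp add: space_prob_algebra)
qed

text \<open>The one-step bound is uniform in the current state, so composition multiplies the
  factors and the exponents add up.\<close>

lemma dpsgd_run_renyi_dominated:
  assumes K: "\<And>t. dpsgd_step g W S \<eta> s2 t \<in> borel \<rightarrow>\<^sub>M prob_algebra borel"
      "\<And>t. dpsgd_step g W S' \<eta> s2 t \<in> borel \<rightarrow>\<^sub>M prob_algebra borel"
    and dom: "\<And>t y. renyi_dominated (exp a) q (dpsgd_step g W S \<eta> s2 t y) (dpsgd_step g W S' \<eta> s2 t y)"
    and q: "0 < q"
  shows "renyi_dominated (exp (real T * a)) q (dpsgd_run g W S \<eta> s2 T) (dpsgd_run g W S' \<eta> s2 T)"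
proof (induction T)
  case 0
  then show ?case using q by (simp add: renyi_dominated_return)
next
  case (Suc T)
  have "renyi_dominated (exp a * exp (real T * a)) q
      (dpsgd_run g W S \<eta> s2 T \<bind> dpsgd_step g W S \<eta> s2 (Suc T)) (dpsgd_run g W S' \<eta> s2 T \<bind> dpsgd_step g W S' \<eta> s2 (Suc T))"
    using dpsgd_run_prob_space[OF K(1)] dpsgd_run_prob_space[OF K(2)] q
    by (intro renyi_dominated_bind[OF Suc K dom]) auto
  then show ?case by (simp add: exp_add algebra_simps)
qed

text \<open>Serves the case \<open>G = 0\<close>, in which the variance vanishes and the Gaussian
  lemmas, stated for \<open>s2 > 0\<close>, do not apply. The steps never see the data then,
  whatever \<open>gauss_vec\<close> is.\<close>

lemma dpsgd_cong_zero_gradient: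
  assumes "\<And>z w. g w z = 0" "length S = length S'"
  shows "dpsgd g W \<eta> s2 T S = dpsgd g W \<eta> s2 T S'"
proof -
  have "dpsgd_step g W S \<eta> s2 = dpsgd_step g W S' \<eta> s2"
    using assms by (simp add: dpsgd_step_def fun_eq_iff)
  then have "dpsgd_run g W S \<eta> s2 T = dpsgd_run g W S' \<eta> s2 T"
    by (induction T) auto
  then show ?thesis by (simp add: dpsgd_def)
qed

section \<open>The choice of the order and the privacy budget\<close>

theorem theorem1:
  fixes f :: "'a::euclidean_space \<Rightarrow> 'z \<Rightarrow> real"
    and g :: "'a \<Rightarrow> 'z \<Rightarrow> 'a"
    and W :: "'a set"
    and \<eta> :: "nat \<Rightarrow> real"
    and G \<beta> \<epsilon> \<delta> :: real
    and n T :: nat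
  assumes W: "convex W" "closed W" "W \<noteq> {}"
    and cvx: "\<And>z. convex_on W (\<lambda>w. f w z)"
    and lip: "\<And>z. G-lipschitz_on W (\<lambda>w. f w z)"
    and subgrad: "\<And>z w v. w \<in> W \<Longrightarrow> v \<in> W \<Longrightarrow> f v z \<ge> f w z + g w z \<bullet> (v - w)"
    and subgrad_bound: "\<And>z w. norm (g w z) \<le> G"
    and g_meas: "\<And>z. (\<lambda>w. g w z) \<in> borel_measurable borel"
    and n: "n > 0" and T: "T > 0"
    and \<beta>: "0 < \<beta>" "\<beta> < 1"
    and \<epsilon>: "\<epsilon> > 0"
    and \<delta>: "0 < \<delta>" "\<delta> < 1"
    and sig: "dpsgd_sigma2 G T n \<beta> \<epsilon> \<delta> \<ge> 2.68 * G^2"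
    and cond: "let s2 = dpsgd_sigma2 G T n \<beta> \<epsilon> \<delta>;
                   lam = ln (1/\<delta>) / ((1 - \<beta>) * \<epsilon>) + 1
               in lam - 1 \<le> s2 / (6 * G^2) * ln (real n / (lam * (1 + s2 / (4 * G^2))))"
  shows "diff_private (dpsgd g W \<eta> (dpsgd_sigma2 G T n \<beta> \<epsilon> \<delta>) T) n \<epsilon> \<delta>"
  unfolding diff_private_def
proof (intro allI impI ballI)
  fix S S' :: "'z list" and E :: "'a set"
  assume len: "length S = n" "length S' = n" and diff: "card {i. i < n \<and> S ! i \<noteq> S' ! i} = 1" and E: "E \<in> sets borel"
  define s2 where "s2 = dpsgd_sigma2 G T n \<beta> \<epsilon> \<delta>"
  define l where "l = ln (1/\<delta>) / ((1 - \<beta>) * \<epsilon>) + 1"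
  have "measure (dpsgd g W \<eta> s2 T S) E \<le> exp \<epsilon> * measure (dpsgd g W \<eta> s2 T S') E + \<delta>"
  proof (cases "G = 0")
    case True
    then have "g w z = 0" for w z using subgrad_bound[of w z] by simp
    then have "dpsgd g W \<eta> s2 T S = dpsgd g W \<eta> s2 T S'"
      using len by (intro dpsgd_cong_zero_gradient) auto
    moreover have "1 * measure (dpsgd g W \<eta> s2 T S') E \<le> exp \<epsilon> * measure (dpsgd g W \<eta> s2 T S') E"
      using \<epsilon> by (intro mult_right_mono) auto
    ultimately show ?thesis using \<delta> by simp
  next
    case False
    have "0 \<le> G" using order_trans[OF norm_ge_zero subgrad_bound] .
    with False have G: "0 < G" by simp
    have s2: "2.68 * G\<^sup>2 \<le> s2" using sig by (simp add: s2_def)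
    moreover have "0 < 2.68 * G\<^sup>2" using G by simp
    ultimately have s2_pos: "0 < s2" by linarith
    have l: "1 < l" using \<delta> \<beta> \<epsilon> by (simp add: l_def)
    define x where "x = 4 * G\<^sup>2 / s2"
    have x: "0 < x" "x \<le> 1 / 0.67" using s2 s2_pos G by (auto simp: x_def field_simps)
    have inv_x: "s2 / (4 * G\<^sup>2) = 1 / x" "s2 / (6 * G\<^sup>2) = 1 / (1.5 * x)"
      using s2_pos G by (auto simp: x_def field_simps)
    \<comment> \<open>In terms of \<open>x\<close> the logarithmic hypothesis exponentiates to
      exactly the smallness of \<open>1 / real n\<close> that the one-step bound requires.\<close>
    have "l - 1 \<le> s2 / (6 * G\<^sup>2) * ln (real n / (l * (1 + s2 / (4 * G\<^sup>2))))"
      using cond by (simp add: Let_def s2_def l_def)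
    then have "1.5 * (l - 1) * x \<le> ln (real n / (l * (1 + 1 / x)))"
      unfolding inv_x using x by (simp add: field_simps)
    moreover define c where "c = l * (1 + 1 / x)"
    ultimately have "1.5 * (l - 1) * x \<le> ln (real n / c)" by (simp only:)
    moreover have c: "0 < c" unfolding c_def using x l by (intro mult_pos_pos add_pos_pos) auto
    moreover have "0 < real n / c" using n c by simp
    ultimately have "exp (1.5 * (l - 1) * x) \<le> real n / c"
      by (simp only: ln_ge_iff)
    then have "exp (1.5 * (l - 1) * x) * c \<le> real n"
      using c by (simp add: pos_le_divide_eq)
    then have "1 / real n \<le> 1 / (exp (1.5 * (l - 1) * x) * c)"
      using c n by (intro divide_left_mono mult_pos_pos) auto
    also have "\<dots> = exp (- 1.5 * (l - 1) * x) / (l * (1 + 1 / x))"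
      unfolding c_def[symmetric] mult_minus_left exp_minus
      by (simp only: divide_inverse inverse_mult_distrib mult_1_left)
    finally have p: "1 / real n \<le> exp (- 1.5 * (l - 1) * x) / (l * (1 + 1 / x))" .
    obtain j where j: "{i. i < n \<and> S ! i \<noteq> S' ! i} = {j}"
      using diff by (rule card_1_singletonE)
    have jn: "j < n" "\<And>i. i < n \<Longrightarrow> i \<noteq> j \<Longrightarrow> S ! i = S' ! i" using j by auto
    note step = dpsgd_step_measurable[where g = g, OF W g_meas s2_pos]
    have q: "0 < l / (l - 1)" using l by simp
    \<comment> \<open>Here the variance formula enters: 7/2 times the 4 in \<open>x\<close> cancels
      its 14, and the \<open>T\<close> steps together cost \<beta> * \<epsilon>.\<close>
    have budget: "real T * ((l - 1) / l * (7 / 2 * l * x / (real n)\<^sup>2)) = (l - 1) / l * (\<beta> * \<epsilon>)"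
    proof -
      have "s2 = 14 * G\<^sup>2 * real T / (\<beta> * (real n)\<^sup>2 * \<epsilon>) * l"
        by (simp add: s2_def dpsgd_sigma2_def l_def)
      then have "s2 * (\<beta> * (real n)\<^sup>2 * \<epsilon>) = 14 * G\<^sup>2 * real T * l"
        using \<beta> \<epsilon> n by simp
      then have "\<beta> * \<epsilon> = 14 * G\<^sup>2 * real T * l / (s2 * (real n)\<^sup>2)"
        using s2_pos n by (simp add: eq_divide_eq mult_ac)
      also have "\<dots> = real T * (7 / 2 * l * x / (real n)\<^sup>2)"
        by (simp add: x_def)
      finally show ?thesis by (simp only: mult.left_commute)
    qed
    have "renyi_dominated (exp (real T * ((l - 1) / l * (7 / 2 * l * x / (real n)\<^sup>2)))) (l / (l - 1))
        (dpsgd_run g W S \<eta> s2 T) (dpsgd_run g W S' \<eta> s2 T)"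
      by (intro dpsgd_run_renyi_dominated step q
          dpsgd_step_renyi_dominated[OF W subgrad_bound len jn s2_pos G x_def x(2) l p])
    then have dom: "renyi_dominated (exp ((l - 1) / l * (\<beta> * \<epsilon>))) (l / (l - 1))
        (dpsgd_run g W S \<eta> s2 T) (dpsgd_run g W S' \<eta> s2 T)"
      unfolding budget .
    have run: "prob_space (dpsgd_run g W R \<eta> s2 T)" "sets (dpsgd_run g W R \<eta> s2 T) = sets borel" for R
      using dpsgd_run_prob_space[OF step] by auto
    \<comment> \<open>The output is a function of the final state, so the event is pulled back to
      the pairs.\<close>
    define E' where "E' = (\<lambda>(w, acc). (1 / real T) *\<^sub>R acc) -` E \<inter> (UNIV :: ('a \<times> 'a) set)"
    have out [measurable]: "(\<lambda>(w, acc). (1 / real T) *\<^sub>R acc) \<in> (borel :: ('a \<times> 'a) measure) \<rightarrow>\<^sub>M borel"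
      unfolding borel_prod[symmetric] by measurable
    have E': "E' \<in> sets borel"
      unfolding E'_def using measurable_sets[OF out E] by simp
    have out': "(\<lambda>(w, acc). (1 / real T) *\<^sub>R acc) \<in> dpsgd_run g W R \<eta> s2 T \<rightarrow>\<^sub>M borel" for R
      using out by (simp only: measurable_cong_sets[OF run(2) refl])
    have meas: "measure (dpsgd g W \<eta> s2 T R) E = measure (dpsgd_run g W R \<eta> s2 T) E'" for R
    proof -
      have "space (dpsgd_run g W R \<eta> s2 T) = UNIV"
        using sets_eq_imp_space_eq[OF run(2)] by simp
      then show ?thesis
        unfolding dpsgd_def measure_distr[OF out' E] by (simp only: E'_def)
    qed
    have "measure (dpsgd_run g W S \<eta> s2 T) E' \<le>
       exp (\<beta> * \<epsilon> + ln (1 / \<delta>) / (l - 1)) * measure (dpsgd_run g W S' \<eta> s2 T) E' + \<delta>"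
      using E' run l \<delta> by (intro renyi_dominated_approx_DP[OF dom]) (auto intro: prob_space.finite_measure)
    \<comment> \<open>The order \<open>l\<close> is the one for which the conversion costs exactly
      \<open>(1 - \<beta>) * \<epsilon>\<close>; cancelling the logarithm uses \<delta> < 1.\<close>
    also have "\<beta> * \<epsilon> + ln (1 / \<delta>) / (l - 1) = \<epsilon>"
    proof -
      have "ln (1 / \<delta>) \<noteq> 0" using \<delta> by simp
      then have "ln (1 / \<delta>) / (l - 1) = (1 - \<beta>) * \<epsilon>" using \<beta> \<epsilon> by (simp add: l_def)
      then show ?thesis by (simp add: algebra_simps)
    qed
    finally show ?thesis unfolding meas .
  qed
  then show "measure (dpsgd g W \<eta> (dpsgd_sigma2 G T n \<beta> \<epsilon> \<delta>) T S) E \<le>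
      exp \<epsilon> * measure (dpsgd g W \<eta> (dpsgd_sigma2 G T n \<beta> \<epsilon> \<delta>) T S') E + \<delta>"
    unfolding s2_def .
qed

end
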